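(* Let $\mathbb K=\mathbb R$ and let $\mathfrak g=\mathfrak k\,\widetilde{\rtimes}\,\mathfrak a$ be a reduced semidirect product with 1-dimensional center $\mathfrak z$, where the Lie algebra $\mathfrak k$ admits a grading $\gamma=(\mathfrak z,\mathfrak c,\mathcal V)$ of type $(A_+)$, and $\mathfrak a$ is a nilpotent Lie algebra with $[\mathfrak a,\mathfrak a]\subseteq\mathfrak z$ which is compatible with the grading $\gamma$. Then the following assertions hold: (1) The (connected, simply connected) Lie group associated with $\mathfrak k\,\widetilde{\rtimes}\,\mathfrak a$ has flat generic coadjoint orbits if and only if either $\mathfrak a=\mathfrak z$ or $\mathfrak a$ is a Heisenberg algebra. (2) If this is the case, then there is a maximal abelian ideal of $\mathfrak k\,\widetilde{\rtimes}\,\mathfrak a$ which is a polarization at every point of a generic coadjoint orbit.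
   Context: All Lie algebras are finite-dimensional over $\mathbb R$; $\dotplus$ denotes direct sum of vector (sub)spaces; $\mathcal Z(\cdot)$ denotes the center. A Heisenberg algebra is a Lie algebra isomorphic to $\mathfrak h_{\mathcal W}=\mathbb R\times\mathcal W^*\times\mathcal W$ with bracket $[(t,\xi,w),(t',\xi',w')]=(\xi(w')-\xi'(w),0,0)$, for a finite-dimensional vector space $\mathcal W$. A grading of type $(A_+)$ of a nilpotent Lie algebra $\mathfrak k$ with $\dim\mathcal Z(\mathfrak k)=1$ is a triple $\gamma=(\mathfrak z,\mathfrak c,\mathcal V)$ of linear subspaces with $\mathfrak k=\mathfrak z\dotplus\mathfrak c\dotplus\mathcal V$, $\mathfrak z=\mathcal Z(\mathfrak k)$, $[\mathfrak c,\mathfrak c]=0$, $[\mathcal V,\mathcal V]\subseteq\mathfrak c$, and such that the Lie bracket gives rise to a duality pairing (nondegenerate bilinear map) $[\cdot,\cdot]\colon\mathfrak c\times\mathcal V\to\mathcal Z(\mathfrak k)\simeq\mathbb R$. If $\mathfrak k$ and $\mathfrak a$ are subalgebras of a Lie algebra $\mathfrak g$ with $[\mathfrak a,\mathfrak k]\subseteq\mathfrak k$ and $\mathfrak k$ has a grading $\gamma=(\mathfrak z,\mathfrak c,\mathcal V)$ of type $(A_+)$, then $\mathfrak a$ is compatible with $\gamma$ if $[\mathfrak a,\mathcal V]\subseteq\mathfrak c$ and $[\mathfrak a,\mathfrak z+\mathfrak c]=0$. A Lie algebra $\mathfrak g$ with $\dim\mathcal Z(\mathfrak g)=1$ and two subalgebras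 $\mathfrak k,\mathfrak a$ is the reduced semidirect product $\mathfrak g=\mathfrak k\,\widetilde{\rtimes}\,\mathfrak a$ if $[\mathfrak a,\mathfrak k]\subseteq\mathfrak k$, $\mathfrak g=\mathfrak k+\mathfrak a$ and $\mathcal Z(\mathfrak g)=\mathfrak k\cap\mathfrak a$. Coadjoint orbit terminology: for the connected simply connected nilpotent Lie group $G$ with Lie algebra $\mathfrak g$, coadjoint orbits are the $G$-orbits in $\mathfrak g^*$ under the coadjoint action. Generic coadjoint orbits are those of maximal dimension. An orbit is flat if it is an affine subspace of $\mathfrak g^*$; "flat generic coadjoint orbits" means that the generic orbits are flat. For $\xi\in\mathfrak g^*$ put $\mathfrak g_\xi=\{X\in\mathfrak g\mid\xi([X,\mathfrak g])=0\}$; a polarization at $\xi$ is a subalgebra $\mathfrak p\subseteq\mathfrak g$ with $\xi([\mathfrak p,\mathfrak p])=0$ and $\dim\mathfrak p=\frac12(\dim\mathfrak g+\dim\mathfrak g_\xi)$. *)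

theory Defs
  imports "HOL-Analysis.Analysis"
begin

text \<open>
  A finite-dimensional real Lie algebra is a type of class \<open>euclidean_space\<close> (which serves only as
  a finite-dimensional real vector space with its usual topology) together with a bracket on it.
  Subalgebras are sets.
\<close>

locale lie_algebra =
  fixes br :: "'g::euclidean_space \<Rightarrow> 'g \<Rightarrow> 'g"
  assumes bilinear_br: "bilinear br"
    and br_self: "br x x = 0"
    and jacobi: "br x (br y z) + br y (br z x) + br z (br x y) = 0"

definition lie_subalgebra :: "('g::real_vector \<Rightarrow> 'g \<Rightarrow> 'g) \<Rightarrow> 'g set \<Rightarrow> bool" where
  "lie_subalgebra br S \<longleftrightarrow> subspace S \<and> (\<forall>x\<in>S. \<forall>y\<in>S. br x y \<in> S)"

definition lie_center :: "('g::real_vector \<Rightarrow> 'g \<Rightarrow> 'g) \<Rightarrow> 'g set \<Rightarrow> 'g set" where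
  "lie_center br S = {x \<in> S. \<forall>y\<in>S. br x y = 0}"

fun lower_central :: "('g::real_vector \<Rightarrow> 'g \<Rightarrow> 'g) \<Rightarrow> 'g set \<Rightarrow> nat \<Rightarrow> 'g set" where
  "lower_central br S 0 = S"
| "lower_central br S (Suc n) = span {br x y | x y. x \<in> S \<and> y \<in> lower_central br S n}"

definition lie_nilpotent :: "('g::real_vector \<Rightarrow> 'g \<Rightarrow> 'g) \<Rightarrow> 'g set \<Rightarrow> bool" where
  "lie_nilpotent br S \<longleftrightarrow> (\<exists>n. lower_central br S n = {0})"

definition lie_abelian :: "('g::real_vector \<Rightarrow> 'g \<Rightarrow> 'g) \<Rightarrow> 'g set \<Rightarrow> bool" where
  "lie_abelian br S \<longleftrightarrow> (\<forall>x\<in>S. \<forall>y\<in>S. br x y = 0)"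

definition lie_ideal :: "('g::real_vector \<Rightarrow> 'g \<Rightarrow> 'g) \<Rightarrow> 'g set \<Rightarrow> bool" where
  "lie_ideal br I \<longleftrightarrow> subspace I \<and> (\<forall>x. \<forall>y\<in>I. br x y \<in> I)"

definition maximal_abelian_ideal :: "('g::real_vector \<Rightarrow> 'g \<Rightarrow> 'g) \<Rightarrow> 'g set \<Rightarrow> bool" where
  "maximal_abelian_ideal br I \<longleftrightarrow> lie_ideal br I \<and> lie_abelian br I \<and>
     (\<forall>J. lie_ideal br J \<and> lie_abelian br J \<and> I \<subseteq> J \<longrightarrow> J = I)"

text \<open>Every linear map between subspaces extends to the whole type, so \<open>linear f\<close> is no restriction.\<close>

definition lie_isomorphic ::
  "('a::real_vector \<Rightarrow> 'a \<Rightarrow> 'a) \<Rightarrow> 'a set \<Rightarrow> ('b::real_vector \<Rightarrow> 'b \<Rightarrow> 'b) \<Rightarrow> 'b set \<Rightarrow> bool" where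
  "lie_isomorphic br S br' T \<longleftrightarrow>
     (\<exists>f. linear f \<and> bij_betw f S T \<and> (\<forall>x\<in>S. \<forall>y\<in>S. f (br x y) = br' (f x) (f y)))"

text \<open>
  The model \<open>\<real> \<times> W* \<times> W\<close> for a subspace \<open>W\<close>: a functional on \<open>W\<close> is represented by its unique
  linear extension that vanishes on the orthogonal complement of \<open>W\<close>.
\<close>

definition heisenberg_bracket ::
  "real \<times> ('w::euclidean_space \<Rightarrow>\<^sub>L real) \<times> 'w \<Rightarrow> real \<times> ('w \<Rightarrow>\<^sub>L real) \<times> 'w
     \<Rightarrow> real \<times> ('w \<Rightarrow>\<^sub>L real) \<times> 'w" where
  "heisenberg_bracket =
     (\<lambda>(t, \<xi>, w) (t', \<xi>', w'). (blinfun_apply \<xi> w' - blinfun_apply \<xi>' w, 0, 0))"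

definition dual_of_subspace :: "'w::euclidean_space set \<Rightarrow> ('w \<Rightarrow>\<^sub>L real) set" where
  "dual_of_subspace W = {\<xi>. \<forall>x. (\<forall>w\<in>W. x \<bullet> w = 0) \<longrightarrow> blinfun_apply \<xi> x = 0}"

definition heisenberg_carrier ::
  "'w::euclidean_space set \<Rightarrow> (real \<times> ('w \<Rightarrow>\<^sub>L real) \<times> 'w) set" where
  "heisenberg_carrier W = UNIV \<times> dual_of_subspace W \<times> W"

text \<open>
  It suffices to let \<open>W\<close> range over the subspaces of the ambient space: an isomorphism forces
  \<open>dim W \<le> dim S\<close>, so any finite-dimensional \<open>W\<close> that occurs is isomorphic to such a subspace.
  The case \<open>W = {0}\<close> is included.
\<close>

definition heisenberg_algebra :: "('g::euclidean_space \<Rightarrow> 'g \<Rightarrow> 'g) \<Rightarrow> 'g set \<Rightarrow> bool" where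
  "heisenberg_algebra br S \<longleftrightarrow>
     (\<exists>W::'g set. subspace W \<and> lie_isomorphic heisenberg_bracket (heisenberg_carrier W) br S)"

definition direct_sum3 ::
  "'g::real_vector set \<Rightarrow> 'g set \<Rightarrow> 'g set \<Rightarrow> 'g set \<Rightarrow> bool" where
  "direct_sum3 S A B C \<longleftrightarrow> subspace A \<and> subspace B \<and> subspace C \<and>
     S = {a + b + c | a b c. a \<in> A \<and> b \<in> B \<and> c \<in> C} \<and>
     (\<forall>a\<in>A. \<forall>b\<in>B. \<forall>c\<in>C. a + b + c = 0 \<longrightarrow> a = 0 \<and> b = 0 \<and> c = 0)"

definition duality_pairing ::
  "('g::real_vector \<Rightarrow> 'g \<Rightarrow> 'g) \<Rightarrow> 'g set \<Rightarrow> 'g set \<Rightarrow> 'g set \<Rightarrow> bool" where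
  "duality_pairing br C V Z \<longleftrightarrow>
     (\<forall>c\<in>C. \<forall>v\<in>V. br c v \<in> Z) \<and>
     (\<forall>c\<in>C. (\<forall>v\<in>V. br c v = 0) \<longrightarrow> c = 0) \<and>
     (\<forall>v\<in>V. (\<forall>c\<in>C. br c v = 0) \<longrightarrow> v = 0)"

definition grading_Aplus ::
  "('g::real_vector \<Rightarrow> 'g \<Rightarrow> 'g) \<Rightarrow> 'g set \<Rightarrow> 'g set \<Rightarrow> 'g set \<Rightarrow> 'g set \<Rightarrow> bool" where
  "grading_Aplus br k z c V \<longleftrightarrow>
     lie_subalgebra br k \<and> lie_nilpotent br k \<and> dim (lie_center br k) = 1 \<and>
     direct_sum3 k z c V \<and>
     z = lie_center br k \<and>
     (\<forall>x\<in>c. \<forall>y\<in>c. br x y = 0) \<and>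
     (\<forall>x\<in>V. \<forall>y\<in>V. br x y \<in> c) \<and>
     duality_pairing br c V (lie_center br k)"

definition compatible_with_grading ::
  "('g::real_vector \<Rightarrow> 'g \<Rightarrow> 'g) \<Rightarrow> 'g set \<Rightarrow> 'g set \<Rightarrow> 'g set \<Rightarrow> 'g set \<Rightarrow> bool" where
  "compatible_with_grading br a z c V \<longleftrightarrow>
     (\<forall>x\<in>a. \<forall>v\<in>V. br x v \<in> c) \<and>
     (\<forall>x\<in>a. \<forall>s\<in>z. \<forall>y\<in>c. br x (s + y) = 0)"

definition reduced_semidirect_product ::
  "('g::real_vector \<Rightarrow> 'g \<Rightarrow> 'g) \<Rightarrow> 'g set \<Rightarrow> 'g set \<Rightarrow> bool" where
  "reduced_semidirect_product br k a \<longleftrightarrow>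
     dim (lie_center br UNIV) = 1 \<and>
     lie_subalgebra br k \<and> lie_subalgebra br a \<and>
     (\<forall>x\<in>a. \<forall>y\<in>k. br x y \<in> k) \<and>
     UNIV = {x + y | x y. x \<in> k \<and> y \<in> a} \<and>
     lie_center br UNIV = k \<inter> a"

text \<open>\<open>exp_ad br X\<close> is \<open>Ad (exp X)\<close>, the exponential of \<open>ad X\<close>.\<close>

definition exp_ad :: "('g::euclidean_space \<Rightarrow> 'g \<Rightarrow> 'g) \<Rightarrow> 'g \<Rightarrow> 'g \<Rightarrow> 'g" where
  "exp_ad br X Y = (\<Sum>n. ((br X) ^^ n) Y /\<^sub>R fact n)"

text \<open>
  A connected Lie group \<open>G\<close> is generated by the image of its exponential map, so \<open>Ad(G)\<close> is the
  group generated by the maps \<open>exp_ad br X\<close>. Since \<open>exp_ad br (- X)\<close> is the inverse of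
  \<open>exp_ad br X\<close>, closing up under composition is enough. The (co)adjoint orbits of \<open>G\<close> are those
  of \<open>Ad(G)\<close>.
\<close>

inductive_set Ad_group :: "('g::euclidean_space \<Rightarrow> 'g \<Rightarrow> 'g) \<Rightarrow> ('g \<Rightarrow> 'g) set"
  for br where
  "id \<in> Ad_group br"
| "A \<in> Ad_group br \<Longrightarrow> exp_ad br X \<circ> A \<in> Ad_group br"

text \<open>
  The dual space is \<open>'g \<Rightarrow>\<^sub>L real\<close>, as all linear functionals are bounded in finite dimension;
  \<open>Ad*(g) \<xi> = \<xi> \<circ> Ad(g)\<inverse>\<close>.
\<close>

definition coadjoint ::
  "('g::euclidean_space \<Rightarrow> 'g) \<Rightarrow> ('g \<Rightarrow>\<^sub>L real) \<Rightarrow> ('g \<Rightarrow>\<^sub>L real)" where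
  "coadjoint A \<xi> = Blinfun (\<lambda>x. blinfun_apply \<xi> (inv A x))"

definition coadjoint_orbit ::
  "('g::euclidean_space \<Rightarrow> 'g \<Rightarrow> 'g) \<Rightarrow> ('g \<Rightarrow>\<^sub>L real) \<Rightarrow> ('g \<Rightarrow>\<^sub>L real) set" where
  "coadjoint_orbit br \<xi> = {coadjoint A \<xi> | A. A \<in> Ad_group br}"

text \<open>
  The tangent space at \<open>\<xi>\<close> of the orbit through \<open>\<xi>\<close>, i.e. the image of the differential of the
  orbit map \<open>g \<mapsto> Ad*(g) \<xi>\<close> at the identity: the velocities at \<open>0\<close> of the curves
  \<open>t \<mapsto> Ad*(exp tX) \<xi>\<close>. The dimension of the orbit as a manifold is that of its tangent space.
\<close>

definition orbit_tangent_space ::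
  "('g::euclidean_space \<Rightarrow> 'g \<Rightarrow> 'g) \<Rightarrow> ('g \<Rightarrow>\<^sub>L real) \<Rightarrow> ('g \<Rightarrow>\<^sub>L real) set" where
  "orbit_tangent_space br \<xi> =
     {v. \<exists>X. ((\<lambda>t. coadjoint (exp_ad br (t *\<^sub>R X)) \<xi>) has_vector_derivative v) (at 0)}"

definition orbit_dim :: "('g::euclidean_space \<Rightarrow> 'g \<Rightarrow> 'g) \<Rightarrow> ('g \<Rightarrow>\<^sub>L real) \<Rightarrow> nat" where
  "orbit_dim br \<xi> = dim (orbit_tangent_space br \<xi>)"

definition generic_orbits ::
  "('g::euclidean_space \<Rightarrow> 'g \<Rightarrow> 'g) \<Rightarrow> ('g \<Rightarrow>\<^sub>L real) set set" where
  "generic_orbits br =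
     {coadjoint_orbit br \<xi> | \<xi>. \<forall>\<eta>. orbit_dim br \<eta> \<le> orbit_dim br \<xi>}"

definition flat_generic_orbits :: "('g::euclidean_space \<Rightarrow> 'g \<Rightarrow> 'g) \<Rightarrow> bool" where
  "flat_generic_orbits br \<longleftrightarrow> (\<forall>\<O>\<in>generic_orbits br. affine \<O>)"

definition isotropy :: "('g::euclidean_space \<Rightarrow> 'g \<Rightarrow> 'g) \<Rightarrow> ('g \<Rightarrow>\<^sub>L real) \<Rightarrow> 'g set" where
  "isotropy br \<xi> = {X. \<forall>Y. blinfun_apply \<xi> (br X Y) = 0}"

definition polarization ::
  "('g::euclidean_space \<Rightarrow> 'g \<Rightarrow> 'g) \<Rightarrow> ('g \<Rightarrow>\<^sub>L real) \<Rightarrow> 'g set \<Rightarrow> bool" where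
  "polarization br \<xi> p \<longleftrightarrow> lie_subalgebra br p \<and>
     (\<forall>x\<in>p. \<forall>y\<in>p. blinfun_apply \<xi> (br x y) = 0) \<and>
     real (dim p) = (real (DIM('g)) + real (dim (isotropy br \<xi>))) / 2"

end

theory Submission
  imports Defs
begin

text \<open>
  Since \<open>z \<subseteq> a\<close>, one has \<open>g = c \<oplus> V \<oplus> a\<close>, and \<open>ad X\<close> is nilpotent of order 3, so
  \<open>Ad (exp X)\<close> is a quadratic polynomial in \<open>ad X\<close>. Everything is governed by the center \<open>R\<close> of
  \<open>a\<close>: eliminating the dual pair \<open>c\<close>, \<open>V\<close> shows that the isotropy algebras have dimension at least
  \<open>dim R\<close>, with equality wherever \<open>\<xi>|z \<noteq> 0\<close>. If \<open>R = z\<close>, moving \<open>\<xi>\<close> successively by \<open>V\<close>, \<open>a\<close> and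
  \<open>c\<close> adjusts its restrictions to \<open>c\<close>, \<open>a\<close> and \<open>V\<close>, so a generic orbit consists of all functionals
  with the same restriction to \<open>z\<close>. If \<open>R \<noteq> z\<close>, an element of \<open>R\<close> outside \<open>z\<close> shows that
  generic orbits are curved. Finally \<open>R = z\<close> says that the bracket is a symplectic form on \<open>a/z\<close>, i.e.
  that \<open>a\<close> is a Heisenberg algebra; for a Lagrangian \<open>L\<close>, i.e. a maximal abelian subspace of \<open>a\<close>
  containing \<open>z\<close>, the sum \<open>c + L\<close> is the common polarization.
\<close>

subsection \<open>Bilinear pairings of subspaces\<close>

lemma orthogonal_split:
  fixes K S :: "'a::euclidean_space set"
  assumes "subspace K" "subspace S" "K \<subseteq> S" "x \<in> S"
  obtains y w where "y \<in> K" "w \<in> S" "\<And>v. v \<in> K \<Longrightarrow> orthogonal v w" "x = y + w"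
proof -
  obtain y w where y: "y \<in> span K" "\<And>v. v \<in> span K \<Longrightarrow> orthogonal w v" "x = y + w"
    using orthogonal_subspace_decomp_exists[of K x] by metis
  then have "y \<in> K" using assms(1) by (metis span_eq_iff)
  moreover have "w \<in> S" using calculation y(3) assms by (metis add_diff_cancel_left' subsetD subspace_diff)
  ultimately show ?thesis using that y(2,3) by (simp add: span_base orthogonal_commute)
qed

text \<open>Rank-nullity for the restriction of \<open>f\<close> to \<open>S\<close>: on the
  orthogonal complement \<open>M\<close> of the kernel inside \<open>S\<close>, \<open>f\<close> is
  injective and has the same image.\<close>

lemma dim_image_plus_dim_kernel:
  fixes f :: "'a::euclidean_space \<Rightarrow> 'b::euclidean_space"
  assumes f: "linear f" and S: "subspace S"
  shows "dim (f ` S) + dim {x \<in> S. f x = 0} = dim S"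
proof -
  define K where "K = {x \<in> S. f x = 0}"
  define M where "M = {y \<in> S. \<forall>x\<in>K. orthogonal x y}"
  have K: "subspace K" "K \<subseteq> S"
    using S by (auto simp: K_def subspace_def linear_0[OF f] linear_add[OF f] linear_scale[OF f])
  have M: "subspace M" "M \<subseteq> S"
    using S by (auto simp: M_def subspace_def orthogonal_def inner_add_right)
  have "dim M + dim K = dim S"
    unfolding M_def by (rule dim_subspace_orthogonal_to_vectors[OF K(1) S K(2)])
  moreover have "f ` S = f ` M"
  proof -
    have "f x \<in> f ` M" if x: "x \<in> S" for x
    proof -
      obtain y w where y: "y \<in> K" "w \<in> S" "\<And>v. v \<in> K \<Longrightarrow> orthogonal v w" "x = y + w"
        using orthogonal_split[OF K(1) S K(2) x] by blast
      then have "f y = 0" by (simp add: K_def)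
      have "w \<in> M" using y by (simp add: M_def)
      moreover have "f x = f w" using y(4) \<open>f y = 0\<close> by (simp add: linear_add[OF f])
      ultimately show ?thesis by blast
    qed
    then show ?thesis using M(2) by blast
  qed
  moreover have "inj_on f (span M)"
  proof -
    have "x = 0" if "x \<in> M" "f x = 0" for x
      using that by (auto simp: M_def K_def orthogonal_def)
    then show ?thesis
      using M(1) linear_inj_on_iff_eq_0[OF f M(1)] by (metis span_eq_iff)
  qed
  then have "dim (f ` M) = dim M" using dim_image_eq[OF f] by blast
  ultimately show ?thesis by (simp add: K_def)
qed

text \<open>Expanding in an orthonormal basis of \<open>T\<close> turns a bilinear form into a
  linear map, so that annihilators of \<open>T\<close> become kernels and rank-nullity
  applies.\<close>

lemma riesz_on_subspace:
  fixes f :: "'a::euclidean_space \<Rightarrow> 'b::euclidean_space \<Rightarrow> real"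
  assumes f: "bilinear f" and T: "subspace T"
  obtains G where "linear G" "range G \<subseteq> T" "\<And>x y. y \<in> T \<Longrightarrow> f x y = G x \<bullet> y"
proof -
  obtain B where B: "B \<subseteq> T" "pairwise orthogonal B" "\<And>x. x \<in> B \<Longrightarrow> norm x = 1"
      "independent B" "span B = T"
    using orthonormal_basis_subspace[OF T] by metis
  have fin: "finite B" using B(4) by (rule independent_imp_finite)
  define G where "G x = (\<Sum>b\<in>B. f x b *\<^sub>R b)" for x
  have "linear G"
    unfolding G_def using f
    by (intro linearI) (simp_all add: bilinear_ladd bilinear_lmul algebra_simps sum.distrib scaleR_sum_right)
  moreover have "G x \<in> T" for x
    unfolding G_def using B(1) by (intro subspace_sum[OF T] subspace_scale[OF T]) blast
  then have "range G \<subseteq> T" by blast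
  moreover have "f x y = G x \<bullet> y" if "y \<in> T" for x y
  proof -
    have y: "(\<Sum>b\<in>B. (y \<bullet> b) *\<^sub>R b) = y"
      using B that fin by (intro orthonormal_basis_expand) auto
    have lin: "linear (f x)" using f by (simp add: bilinear_def)
    have "f x y = f x (\<Sum>b\<in>B. (y \<bullet> b) *\<^sub>R b)" by (simp only: y)
    also have "\<dots> = G x \<bullet> y"
      by (simp add: linear_sum[OF lin] linear_scale[OF lin] G_def inner_sum_left inner_commute[of y] mult.commute)
    finally show ?thesis .
  qed
  ultimately show ?thesis using that by blast
qed

text \<open>The annihilator is the kernel of the Riesz map \<open>G\<close>, whose image lies in
  \<open>T\<close>. Degenerate forms are covered, so the bound serves at every functional.\<close>

lemma dim_le_dim_plus_annihilator:
  fixes f :: "'a::euclidean_space \<Rightarrow> 'b::euclidean_space \<Rightarrow> real"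
  assumes f: "bilinear f" and S: "subspace S" and T: "subspace T"
  shows "dim S \<le> dim T + dim {x \<in> S. \<forall>y\<in>T. f x y = 0}"
proof -
  obtain G where G: "linear G" "range G \<subseteq> T" "\<And>x y. y \<in> T \<Longrightarrow> f x y = G x \<bullet> y"
    using riesz_on_subspace[OF f T] by metis
  have "G x = 0 \<longleftrightarrow> (\<forall>y\<in>T. f x y = 0)" for x
  proof
    assume "\<forall>y\<in>T. f x y = 0"
    then have "G x \<bullet> G x = 0" using G(2,3) by (metis rangeI subsetD)
    then show "G x = 0" by simp
  qed (simp add: G(3))
  then have "{x \<in> S. \<forall>y\<in>T. f x y = 0} = {x \<in> S. G x = 0}" by simp
  moreover have "dim (G ` S) \<le> dim T" using G(2) by (intro dim_subset) blast
  ultimately show ?thesis using dim_image_plus_dim_kernel[OF G(1) S] by simp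
qed

text \<open>Fredholm alternative: the component \<open>w\<close> of the Riesz vector of
  \<open>\<phi>\<close> orthogonal to the image of \<open>S\<close> under \<open>G\<close> is
  annihilated by \<open>S\<close>, so \<open>\<phi> w = 0\<close>, and this forces
  \<open>w = 0\<close>. It is later used to move a functional to prescribed values on a
  subspace.\<close>

lemma pairing_represents_functional:
  fixes f :: "'a::euclidean_space \<Rightarrow> 'b::euclidean_space \<Rightarrow> real"
  assumes f: "bilinear f" and S: "subspace S" and T: "subspace T" and \<phi>: "linear \<phi>"
    and nondeg: "\<And>y. y \<in> T \<Longrightarrow> (\<And>x. x \<in> S \<Longrightarrow> f x y = 0) \<Longrightarrow> \<phi> y = 0"
  obtains x where "x \<in> S" "\<And>y. y \<in> T \<Longrightarrow> f x y = \<phi> y"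
proof -
  obtain G where G: "linear G" "range G \<subseteq> T" "\<And>x y. y \<in> T \<Longrightarrow> f x y = G x \<bullet> y"
    using riesz_on_subspace[OF f T] by metis
  \<comment> \<open>A dummy scalar argument makes \<open>\<phi>\<close> a bilinear form;
    \<open>H 1\<close> is then its Riesz vector.\<close>
  have bil: "bilinear (\<lambda>r::real. \<lambda>y. r * \<phi> y)"
    using \<phi> by (auto simp: bilinear_def linear_iff algebra_simps)
  obtain H where H: "linear H" "range H \<subseteq> T" "\<And>r y. y \<in> T \<Longrightarrow> r * \<phi> y = H r \<bullet> y"
    using riesz_on_subspace[OF bil T] by metis
  have GS: "subspace (G ` S)" using G(1) S by (rule linear_subspace_image)
  obtain u w where u: "u \<in> span (G ` S)" "\<And>v. v \<in> span (G ` S) \<Longrightarrow> orthogonal w v" "H 1 = u + w"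
    using orthogonal_subspace_decomp_exists[of "G ` S" "H 1"] by metis
  have uG: "u \<in> G ` S" using u(1) GS by (metis span_eq_iff)
  then have "u \<in> T" using G(2) by blast
  then have wT: "w \<in> T" using u(3) H(2) T by (metis add_diff_cancel_left' rangeI subsetD subspace_diff)
  have "f x w = 0" if "x \<in> S" for x
    using u(2)[of "G x"] that wT G(3) by (simp add: span_base orthogonal_def inner_commute)
  then have "\<phi> w = 0" using nondeg wT by blast
  then have "(u + w) \<bullet> w = 0" using H(3)[OF wT, of 1] u(3) by simp
  moreover have "u \<bullet> w = 0" using u(2)[OF u(1)] by (simp add: orthogonal_def inner_commute)
  ultimately have "w = 0" by (simp add: inner_add_left)
  then obtain x where "x \<in> S" "H 1 = G x" using u(3) uG by auto
  then show ?thesis using that[of x] G(3) H(3)[of _ 1] by simp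
qed

lemma dim_sum_direct:
  fixes S T :: "'a::euclidean_space set"
  assumes "subspace S" "subspace T" "S \<inter> T = {0}"
  shows "dim {x + y | x y. x \<in> S \<and> y \<in> T} = dim S + dim T"
  using dim_sums_Int[OF assms(1,2)] assms(3) by simp

text \<open>The codomain is a general real vector space because the map of interest goes into the
  dual space \<open>'g \<Rightarrow>\<^sub>L real\<close>.\<close>

lemma dim_injective_image:
  fixes f :: "'a::euclidean_space \<Rightarrow> 'b::real_vector"
  assumes f: "linear f" "inj f" and S: "subspace S"
  shows "dim (f ` S) = dim S"
proof -
  obtain B where B: "independent B" "span B = S" "card B = dim S"
    using basis_subspace_exists[OF S] by metis
  have "independent (f ` B)"
    using linear_independent_injective_image[OF f(1) B(1)] f(2) inj_on_subset by blast
  moreover have "span (f ` B) = span (f ` S)"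
    using B(2) f(1) by (metis linear_span_image span_span)
  ultimately have "dim (f ` S) = card (f ` B)" by (metis dim_eq_card)
  then show ?thesis using B(3) card_image f(2) inj_on_subset by (metis subset_UNIV)
qed

subsection \<open>Functionals on a subspace\<close>

lemma dual_of_subspace_eq_0:
  assumes W: "subspace W" and \<xi>: "\<xi> \<in> dual_of_subspace W"
    and 0: "\<And>w. w \<in> W \<Longrightarrow> blinfun_apply \<xi> w = 0"
  shows "\<xi> = 0"
proof (rule blinfun_eqI)
  fix x
  obtain y w where y: "y \<in> W" "\<And>v. v \<in> W \<Longrightarrow> orthogonal v w" "x = y + w"
    using orthogonal_split[OF W subspace_UNIV, of x] by blast
  then have "blinfun_apply \<xi> w = 0"
    using \<xi> by (simp add: dual_of_subspace_def orthogonal_def inner_commute)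
  then show "blinfun_apply \<xi> x = blinfun_apply 0 x"
    using 0 y by (simp add: blinfun.bilinear_simps)
qed

lemma inner_left_mem_dual_of_subspace:
  "w \<in> W \<Longrightarrow> blinfun_inner_left w \<in> dual_of_subspace W"
  by (simp add: dual_of_subspace_def)

lemma zero_mem_dual_of_subspace: "0 \<in> dual_of_subspace W"
  by (simp add: dual_of_subspace_def)

definition riesz_vector :: "('a::euclidean_space \<Rightarrow>\<^sub>L real) \<Rightarrow> 'a" where
  "riesz_vector \<xi> = (\<Sum>b\<in>Basis. blinfun_apply \<xi> b *\<^sub>R b)"

lemma inner_riesz_vector: "riesz_vector \<xi> \<bullet> x = blinfun_apply \<xi> x"
proof -
  have "blinfun_apply \<xi> x = blinfun_apply \<xi> (\<Sum>b\<in>Basis. (x \<bullet> b) *\<^sub>R b)"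
    by (simp add: euclidean_representation)
  also have "\<dots> = riesz_vector \<xi> \<bullet> x"
    by (simp add: riesz_vector_def inner_sum_left blinfun.sum_right blinfun.scaleR_right
        inner_commute[of x] mult.commute)
  finally show ?thesis by simp
qed

lemma linear_riesz_vector: "linear riesz_vector"
  by (intro linearI) (simp_all add: riesz_vector_def blinfun.bilinear_simps algebra_simps
      sum.distrib scaleR_sum_right)

lemma riesz_vector_inner_left: "riesz_vector (blinfun_inner_left u) = u"
  by (rule vector_eq_rdot[THEN iffD1])
    (simp add: inner_commute[of _ "riesz_vector _"] inner_riesz_vector, simp add: inner_commute)

lemma riesz_vector_mem:
  assumes W: "subspace W" and \<xi>: "\<xi> \<in> dual_of_subspace W"
  shows "riesz_vector \<xi> \<in> W"
proof -
  obtain y w where y: "y \<in> W" "\<And>v. v \<in> W \<Longrightarrow> orthogonal v w" "riesz_vector \<xi> = y + w"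
    using orthogonal_split[OF W subspace_UNIV, of "riesz_vector \<xi>"] by blast
  then have "(y + w) \<bullet> w = 0"
    using \<xi> by (simp add: dual_of_subspace_def orthogonal_def inner_commute flip: inner_riesz_vector)
  then have "w = 0" using y(2)[OF y(1)] by (simp add: inner_add_left orthogonal_def)
  then show ?thesis using y by simp
qed

subsection \<open>The adjoint group and the coadjoint orbits\<close>

context lie_algebra
begin

lemmas br_linear_simps =
  bilinear_ladd[OF bilinear_br] bilinear_radd[OF bilinear_br]
  bilinear_lmul[OF bilinear_br] bilinear_rmul[OF bilinear_br]
  bilinear_lneg[OF bilinear_br] bilinear_rneg[OF bilinear_br]
  bilinear_lsub[OF bilinear_br] bilinear_rsub[OF bilinear_br]
  bilinear_lzero[OF bilinear_br] bilinear_rzero[OF bilinear_br]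

lemma br_anticommute: "br x y = - br y x"
proof -
  have "br (x + y) (x + y) = br x y + br y x"
    by (simp add: br_linear_simps br_self[of x] br_self[of y])
  then show ?thesis by (simp add: br_self eq_neg_iff_add_eq_0)
qed

lemma br_eq_0_commute: "br x y = 0 \<longleftrightarrow> br y x = 0"
  by (metis br_anticommute neg_equal_0_iff_equal)

text \<open>The Jacobi identity in the form that \<open>br x\<close> is a derivation.\<close>

lemma br_br_right: "br x (br y u) = br (br x y) u + br y (br x u)"
proof -
  have "br x (br y u) + br y (br u x) + br u (br x y) = 0" by (rule jacobi)
  moreover have "br y (br u x) = - br y (br x u)"
    using br_anticommute[of u x] by (simp add: br_linear_simps)
  moreover have "br u (br x y) = - br (br x y) u" by (rule br_anticommute)
  ultimately show ?thesis by (simp add: algebra_simps)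
qed

lemma bilinear_apply_br:
  fixes \<xi> :: "'g \<Rightarrow>\<^sub>L real"
  shows "bilinear (\<lambda>x y. blinfun_apply \<xi> (br x y))"
  by (auto simp: bilinear_def linear_iff br_linear_simps blinfun.add_right blinfun.scaleR_right)

lemma subspace_isotropy: "subspace (isotropy br \<xi>)"
  by (auto simp: isotropy_def subspace_def br_linear_simps blinfun.bilinear_simps)

end

section \<open>The decomposition into \<open>c\<close>, \<open>V\<close> and
  \<open>a\<close>\<close>

locale Aplus_semidirect = lie_algebra br for br :: "'g::euclidean_space \<Rightarrow> 'g \<Rightarrow> 'g" +
  fixes k a z c V :: "'g set"
  assumes reduced: "reduced_semidirect_product br k a"
    and center_eq: "lie_center br UNIV = z"
    and grading: "grading_Aplus br k z c V"
    and a_bracket: "\<forall>x\<in>a. \<forall>y\<in>a. br x y \<in> z"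
    and compatible: "compatible_with_grading br a z c V"
begin

lemma subspaces: "subspace z" "subspace c" "subspace V" "subspace a"
  using grading reduced
  unfolding grading_Aplus_def direct_sum3_def reduced_semidirect_product_def lie_subalgebra_def
  by blast+

lemma dim_z: "dim z = 1"
  using reduced unfolding reduced_semidirect_product_def center_eq by blast

lemma k_Int_a: "k \<inter> a = z"
  using reduced unfolding reduced_semidirect_product_def center_eq by blast

lemma z_subset_a: "z \<subseteq> a" using k_Int_a by blast

lemma zero_mems: "0 \<in> z" "0 \<in> c" "0 \<in> V" "0 \<in> a"
  using subspaces by (auto intro: subspace_0)

lemma br_z: assumes "s \<in> z" shows "br s x = 0" "br x s = 0"
  using assms center_eq br_eq_0_commute by (auto simp: lie_center_def)

lemma mem_z_iff: "x \<in> z \<longleftrightarrow> (\<forall>y. br x y = 0)"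
  using center_eq by (auto simp: lie_center_def)

lemma br_c_c: "x \<in> c \<Longrightarrow> y \<in> c \<Longrightarrow> br x y = 0"
  using grading by (simp add: grading_Aplus_def)

lemma br_V_V: "x \<in> V \<Longrightarrow> y \<in> V \<Longrightarrow> br x y \<in> c"
  using grading by (simp add: grading_Aplus_def)

lemma br_c_V: "y \<in> c \<Longrightarrow> v \<in> V \<Longrightarrow> br y v \<in> z"
  using grading by (auto simp: grading_Aplus_def duality_pairing_def)

lemma br_V_c: "y \<in> c \<Longrightarrow> v \<in> V \<Longrightarrow> br v y \<in> z"
  using br_c_V br_anticommute[of v y] subspaces(1) by (simp add: subspace_neg)

lemma nondegenerate_c: "y \<in> c \<Longrightarrow> (\<And>v. v \<in> V \<Longrightarrow> br y v = 0) \<Longrightarrow> y = 0"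
  using grading by (auto simp: grading_Aplus_def duality_pairing_def)

lemma nondegenerate_V: "v \<in> V \<Longrightarrow> (\<And>y. y \<in> c \<Longrightarrow> br y v = 0) \<Longrightarrow> v = 0"
  using grading by (auto simp: grading_Aplus_def duality_pairing_def)

lemma br_a_V: "x \<in> a \<Longrightarrow> v \<in> V \<Longrightarrow> br x v \<in> c"
  using compatible by (simp add: compatible_with_grading_def)

lemma br_V_a: "x \<in> a \<Longrightarrow> v \<in> V \<Longrightarrow> br v x \<in> c"
  using br_a_V br_anticommute[of v x] subspaces(2) by (simp add: subspace_neg)

lemma br_a_c: "x \<in> a \<Longrightarrow> y \<in> c \<Longrightarrow> br x y = 0"
  using compatible zero_mems(1) unfolding compatible_with_grading_def by (metis add_0)

lemma br_c_a: "x \<in> a \<Longrightarrow> y \<in> c \<Longrightarrow> br y x = 0"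
  using br_a_c br_eq_0_commute by blast

lemma br_a_a: "x \<in> a \<Longrightarrow> y \<in> a \<Longrightarrow> br x y \<in> z"
  using a_bracket by blast

text \<open>The central component of the summand in \<open>k\<close> is absorbed into
  \<open>a\<close>, which contains \<open>z\<close>.\<close>

lemma decompose:
  obtains y v w where "y \<in> c" "v \<in> V" "w \<in> a" "x = y + v + w"
proof -
  obtain x' w where x: "x' \<in> k" "w \<in> a" "x = x' + w"
    using reduced unfolding reduced_semidirect_product_def by blast
  obtain s y v where "s \<in> z" "y \<in> c" "v \<in> V" "x' = s + y + v"
    using x(1) grading unfolding grading_Aplus_def direct_sum3_def by blast
  moreover have "s + w \<in> a" using calculation x z_subset_a subspaces(4) by (blast intro: subspace_add)
  ultimately show ?thesis using that[of y v "s + w"] x(3) by (simp add: algebra_simps)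
qed

text \<open>Here \<open>y + v = - w\<close> lies in both \<open>k\<close> and \<open>a\<close>,
  hence in \<open>z\<close>; the directness of the grading of \<open>k\<close> then
  finishes.\<close>

lemma decompose_zero:
  assumes "y \<in> c" "v \<in> V" "w \<in> a" "y + v + w = 0"
  shows "y = 0" "v = 0" "w = 0"
proof -
  have k: "k = {s + y + v | s y v. s \<in> z \<and> y \<in> c \<and> v \<in> V}"
    and uniq: "\<And>s y v. s \<in> z \<Longrightarrow> y \<in> c \<Longrightarrow> v \<in> V \<Longrightarrow> s + y + v = 0 \<Longrightarrow> y = 0 \<and> v = 0"
    using grading unfolding grading_Aplus_def direct_sum3_def by blast+
  have w: "y + v = - w" using assms(4) by (simp add: eq_neg_iff_add_eq_0)
  have "0 + y + v \<in> k" using k assms zero_mems by blast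
  then have "y + v \<in> k" by simp
  moreover have "y + v \<in> a" using w assms(3) subspaces(4) by (simp add: subspace_neg)
  ultimately have "y + v \<in> z" using k_Int_a by blast
  then have "- (y + v) \<in> z" using subspaces(1) by (rule subspace_neg[rotated])
  then have "y = 0 \<and> v = 0" using uniq assms by (metis add.assoc add.left_inverse)
  then show "y = 0" "v = 0" "w = 0" using w by auto
qed

lemma c_Int_a: "c \<inter> a = {0}"
proof -
  have "x = 0" if "x \<in> c" "x \<in> a" for x
    using decompose_zero(1)[of x 0 "-x"] that zero_mems subspaces(4) by (simp add: subspace_neg)
  then show ?thesis using zero_mems by blast
qed

lemma z_generator:
  obtains Z where "z = span {Z}" "Z \<noteq> 0"
proof -
  obtain B where B: "independent B" "span B = z" "card B = dim z"
    using basis_subspace_exists[OF subspaces(1)] by metis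
  then obtain Z where "B = {Z}" using dim_z by (metis card_1_singletonE)
  then show ?thesis using that B dependent_single by metis
qed

text \<open>Nondegeneracy on both sides bounds each of \<open>dim c\<close> and \<open>dim V\<close>
  by the other; the second equation counts dimensions in the direct sum.\<close>

lemma dims: "dim c = dim V" "DIM('g) = 2 * dim c + dim a"
proof -
  obtain Z where Z: "z = span {Z}" "Z \<noteq> 0" by (rule z_generator)
  \<comment> \<open>The inner product with the generator \<open>Z\<close> makes the pairing scalar
    without losing information, since its values are multiples of \<open>Z\<close>.\<close>
  define f where "f x y = br x y \<bullet> Z" for x y
  have f: "bilinear f" "bilinear (\<lambda>x y. f y x)"
    by (auto simp: f_def bilinear_def linear_iff br_linear_simps inner_add_left)
  have f0: "br y v = 0" if "y \<in> c" "v \<in> V" "f y v = 0" for y v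
    using br_c_V[OF that(1,2)] that(3) Z by (auto simp: f_def span_singleton)
  have "{y \<in> c. \<forall>v\<in>V. f y v = 0} = {0}"
    using nondegenerate_c f0 zero_mems by (auto simp: f_def br_linear_simps)
  moreover have "{v \<in> V. \<forall>y\<in>c. f y v = 0} = {0}"
    using nondegenerate_V f0 zero_mems by (auto simp: f_def br_linear_simps)
  ultimately show cV: "dim c = dim V"
    using dim_le_dim_plus_annihilator[OF f(1) subspaces(2,3)]
      dim_le_dim_plus_annihilator[OF f(2) subspaces(3,2)] by simp
  have "V \<inter> a = {0}"
  proof -
    have "x = 0" if "x \<in> V" "x \<in> a" for x
      using decompose_zero(2)[of 0 x "-x"] that zero_mems subspaces(4) by (simp add: subspace_neg)
    then show ?thesis using zero_mems by blast
  qed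
  then have Va: "dim {x + y | x y. x \<in> V \<and> y \<in> a} = dim V + dim a"
    using subspaces by (intro dim_sum_direct) auto
  have sub: "subspace {x + y | x y. x \<in> V \<and> y \<in> a}" using subspaces by (intro subspace_sums)
  have "x = 0" if "x \<in> c" "x = v + w" "v \<in> V" "w \<in> a" for x v w
    using decompose_zero(1)[of x "-v" "-w"] that subspaces by (simp add: subspace_neg)
  then have "c \<inter> {x + y | x y. x \<in> V \<and> y \<in> a} = {0}"
    using zero_mems by (auto intro: exI[of _ 0])
  then have "dim {x + y | x y. x \<in> c \<and> y \<in> {x + y | x y. x \<in> V \<and> y \<in> a}} = dim c + (dim V + dim a)"
    using dim_sum_direct[OF subspaces(2) sub] Va by simp
  moreover have "{x + y | x y. x \<in> c \<and> y \<in> {x + y | x y. x \<in> V \<and> y \<in> a}} = UNIV"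
  proof -
    have "\<exists>y u. x = y + u \<and> y \<in> c \<and> (\<exists>v w. u = v + w \<and> v \<in> V \<and> w \<in> a)" for x
      using decompose[of x] by (metis add.assoc)
    then show ?thesis by auto
  qed
  ultimately show "DIM('g) = 2 * dim c + dim a" using cV by (simp add: dim_UNIV)
qed

section \<open>Nilpotency and the exponential of \<open>br X\<close>\<close>

definition cz :: "'g set" where "cz = {y + s | y s. y \<in> c \<and> s \<in> z}"

lemma subspace_cz: "subspace cz"
  unfolding cz_def using subspaces by (intro subspace_sums)

lemma c_cz: "y \<in> c \<Longrightarrow> y \<in> cz" and z_cz: "y \<in> z \<Longrightarrow> y \<in> cz"
  unfolding cz_def using zero_mems by force+

lemma br_mem_cz: "br x x' \<in> cz"
proof -
  obtain y v w where x: "y \<in> c" "v \<in> V" "w \<in> a" "x = y + v + w" by (rule decompose)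
  obtain y' v' w' where x': "y' \<in> c" "v' \<in> V" "w' \<in> a" "x' = y' + v' + w'" by (rule decompose)
  show ?thesis
    unfolding x(4) x'(4) br_linear_simps
    using x x' br_c_c br_c_V br_V_c br_V_V br_a_V br_V_a br_a_c br_c_a br_a_a zero_mems
    by (intro subspace_add[OF subspace_cz]) (auto intro: c_cz z_cz)
qed

lemma br_cz: assumes "d \<in> cz" shows "br x d \<in> z"
proof -
  obtain y v w where x: "y \<in> c" "v \<in> V" "w \<in> a" "x = y + v + w" by (rule decompose)
  obtain y' s where d: "y' \<in> c" "s \<in> z" "d = y' + s" using assms cz_def by auto
  show ?thesis
    unfolding x(4) d(3) br_linear_simps
    using x d br_c_c br_V_c br_a_c br_z zero_mems by simp
qed

text \<open>Brackets descend one step along the filtration \<open>UNIV\<close>, \<open>cz\<close>,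
  \<open>z\<close>, \<open>{0}\<close>.\<close>

lemma br_three: "br u (br x (br x' y)) = 0"
  using br_cz br_mem_cz br_z by blast

lemma exp_ad_eq: "exp_ad br X Y = Y + br X Y + (1/2) *\<^sub>R br X (br X Y)"
proof -
  have "((br X) ^^ n) Y = 0" if n: "n \<notin> {..<3}" for n
  proof -
    obtain m where m: "n = m + 3" using n by (metis add.commute le_iff_add lessThan_iff not_less)
    show ?thesis unfolding m
      by (induction m) (simp_all add: numeral_3_eq_3 br_three br_linear_simps)
  qed
  then have "exp_ad br X Y = (\<Sum>n\<in>{..<3}. ((br X) ^^ n) Y /\<^sub>R fact n)"
    unfolding exp_ad_def by (intro suminf_finite) auto
  then show ?thesis by (simp add: numeral_3_eq_3)
qed

lemma exp_ad_uminus: "exp_ad br X (exp_ad br (- X) Y) = Y"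
  by (simp add: exp_ad_eq br_linear_simps br_three algebra_simps flip: scaleR_add_left)

lemma exp_ad_inverse: "inv (exp_ad br X) = exp_ad br (- X)" "bij (exp_ad br X)"
proof -
  have "exp_ad br (- X) \<circ> exp_ad br X = id" "exp_ad br X \<circ> exp_ad br (- X) = id"
    using exp_ad_uminus[of X] exp_ad_uminus[of "-X"] by (auto simp: fun_eq_iff)
  then show "bij (exp_ad br X)" "inv (exp_ad br X) = exp_ad br (- X)"
    using o_bij inv_unique_comp by blast+
qed

lemma linear_exp_ad: "linear (exp_ad br X)"
  by (auto simp: linear_iff exp_ad_eq br_linear_simps algebra_simps)

lemma Ad_group_comp: "A \<in> Ad_group br \<Longrightarrow> B \<in> Ad_group br \<Longrightarrow> A \<circ> B \<in> Ad_group br"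
  by (induction rule: Ad_group.induct) (auto simp: comp_assoc intro: Ad_group.intros)

lemma exp_ad_in_Ad_group: "exp_ad br X \<in> Ad_group br"
  using Ad_group.intros(2)[OF Ad_group.intros(1), of br X] by simp

lemma Ad_group_props:
  assumes "A \<in> Ad_group br"
  shows "linear A \<and> bij A \<and> inv A \<in> Ad_group br"
  using assms
proof (induction rule: Ad_group.induct)
  case 1 show ?case using Ad_group.intros(1) by (simp only: linear_id bij_id inv_id simp_thms)
next
  case (2 A X)
  have "inv (exp_ad br X \<circ> A) = inv A \<circ> exp_ad br (- X)"
    using 2 exp_ad_inverse by (metis o_inv_distrib)
  then have "inv (exp_ad br X \<circ> A) \<in> Ad_group br"
    using 2 Ad_group_comp exp_ad_in_Ad_group by simp
  moreover have "linear (exp_ad br X \<circ> A)" using 2 linear_exp_ad linear_compose by blast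
  moreover have "bij (exp_ad br X \<circ> A)" using 2 exp_ad_inverse(2) bij_comp by blast
  ultimately show ?case by blast
qed

section \<open>Coadjoint orbits and their tangent spaces\<close>

lemma coadjoint_apply:
  assumes "A \<in> Ad_group br"
  shows "blinfun_apply (coadjoint A \<xi>) x = blinfun_apply \<xi> (inv A x)"
proof -
  have "linear (inv A)" using assms Ad_group_props by blast
  then have "bounded_linear (\<lambda>x. blinfun_apply \<xi> (inv A x))"
    by (intro bounded_linear_compose[OF blinfun.bounded_linear_right]) (simp add: linear_linear)
  then show ?thesis by (simp add: coadjoint_def bounded_linear_Blinfun_apply)
qed

lemma mem_coadjoint_orbit_iff:
  "\<eta> \<in> coadjoint_orbit br \<xi> \<longleftrightarrow>
    (\<exists>A\<in>Ad_group br. \<forall>x. blinfun_apply \<eta> x = blinfun_apply \<xi> (A x))"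
proof
  assume "\<eta> \<in> coadjoint_orbit br \<xi>"
  then obtain A where "A \<in> Ad_group br" "\<eta> = coadjoint A \<xi>" by (auto simp: coadjoint_orbit_def)
  then show "\<exists>A\<in>Ad_group br. \<forall>x. blinfun_apply \<eta> x = blinfun_apply \<xi> (A x)"
    using coadjoint_apply Ad_group_props by blast
next
  assume "\<exists>A\<in>Ad_group br. \<forall>x. blinfun_apply \<eta> x = blinfun_apply \<xi> (A x)"
  then obtain A where A: "A \<in> Ad_group br" "\<And>x. blinfun_apply \<eta> x = blinfun_apply \<xi> (A x)"
    by blast
  then have "\<eta> = coadjoint (inv A) \<xi>"
    using Ad_group_props[OF A(1)] coadjoint_apply[of "inv A"]
    by (intro blinfun_eqI) (simp add: inv_inv_eq)
  then show "\<eta> \<in> coadjoint_orbit br \<xi>"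
    using Ad_group_props[OF A(1)] by (auto simp: coadjoint_orbit_def)
qed

text \<open>The curve is the polynomial
  \<open>\<xi> + t *\<^sub>R B1 + t\<^sup>2 *\<^sub>R B2\<close>, so its velocity at 0 is
  \<open>B1\<close>; uniqueness of derivatives excludes any other.\<close>

lemma orbit_tangent_space_eq:
  "orbit_tangent_space br \<xi> = range (\<lambda>X. Blinfun (\<lambda>x. - blinfun_apply \<xi> (br X x)))"
proof -
  have "((\<lambda>t. coadjoint (exp_ad br (t *\<^sub>R X)) \<xi>) has_vector_derivative
      Blinfun (\<lambda>x. - blinfun_apply \<xi> (br X x))) (at 0)" for X
  proof -
    define B1 where "B1 = Blinfun (\<lambda>x. - blinfun_apply \<xi> (br X x))"
    define B2 where "B2 = Blinfun (\<lambda>x. blinfun_apply \<xi> (br X (br X x)) / 2)"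
    have "linear (\<lambda>x. - blinfun_apply \<xi> (br X x))" "linear (\<lambda>x. blinfun_apply \<xi> (br X (br X x)) / 2)"
      by (auto simp: linear_iff br_linear_simps blinfun.bilinear_simps)
    then have B: "blinfun_apply B1 x = - blinfun_apply \<xi> (br X x)"
        "blinfun_apply B2 x = blinfun_apply \<xi> (br X (br X x)) / 2" for x
      by (simp_all add: B1_def B2_def bounded_linear_Blinfun_apply linear_linear)
    have "coadjoint (exp_ad br (t *\<^sub>R X)) \<xi> = \<xi> + t *\<^sub>R B1 + t\<^sup>2 *\<^sub>R B2" for t
      by (rule blinfun_eqI)
        (simp add: coadjoint_apply[OF exp_ad_in_Ad_group] exp_ad_inverse exp_ad_eq B
          br_linear_simps blinfun.bilinear_simps power2_eq_square)
    then show ?thesis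
      by (auto intro!: derivative_eq_intros simp: B1_def[symmetric])
  qed
  then show ?thesis
    unfolding orbit_tangent_space_def by (auto dest: vector_derivative_unique_at)
qed

text \<open>Rank-nullity for the Riesz map \<open>G\<close> of the form
  \<open>\<xi> (br x y)\<close>: its kernel is the isotropy algebra, and its range is carried to the
  tangent space by the injective map \<open>J\<close>.\<close>

lemma orbit_dim_eq: "orbit_dim br \<xi> + dim (isotropy br \<xi>) = DIM('g)"
proof -
  obtain G where G: "linear G" "\<And>x y. blinfun_apply \<xi> (br x y) = G x \<bullet> y"
    using riesz_on_subspace[OF bilinear_apply_br subspace_UNIV] by (metis UNIV_I)
  define J where "J u = - blinfun_inner_left u" for u :: 'g
  have J: "linear J"
    unfolding J_def using bounded_linear_minus[OF bounded_linear_blinfun_inner_left]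
    by (rule bounded_linear.linear)
  have "inj J"
  proof (rule injI)
    fix u v assume "J u = J v"
    then have "blinfun_apply (J u) (u - v) = blinfun_apply (J v) (u - v)" by simp
    then have "(u - v) \<bullet> (u - v) = 0" by (simp add: J_def blinfun.minus_left inner_diff_right)
    then show "u = v" by simp
  qed
  have "Blinfun (\<lambda>x. - blinfun_apply \<xi> (br X x)) = J (G X)" for X
  proof -
    have "(\<lambda>x. - blinfun_apply \<xi> (br X x)) = blinfun_apply (J (G X))"
      by (simp add: fun_eq_iff G J_def blinfun.minus_left inner_commute)
    then show ?thesis by (simp add: blinfun_apply_inverse)
  qed
  then have "orbit_tangent_space br \<xi> = J ` range G"
    by (auto simp: orbit_tangent_space_eq)
  then have "orbit_dim br \<xi> = dim (range G)"
    unfolding orbit_dim_def using dim_injective_image[OF J \<open>inj J\<close> linear_subspace_image[OF G(1) subspace_UNIV]] by simp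
  moreover have "isotropy br \<xi> = {x \<in> UNIV. G x = 0}"
    by (auto simp: isotropy_def G)
  ultimately show ?thesis
    using dim_image_plus_dim_kernel[OF G(1) subspace_UNIV] by (simp add: dim_UNIV)
qed

subsection \<open>Generic orbits\<close>

lemma subspace_center_a: "subspace (lie_center br a)"
  using subspaces(4) unfolding lie_center_def subspace_def by (auto simp: br_linear_simps)

lemma z_subset_center_a: "z \<subseteq> lie_center br a"
  using z_subset_a br_z by (auto simp: lie_center_def)

text \<open>As \<open>z\<close> is a line, \<open>\<xi>\<close> is injective on it. This converts
  vanishing of \<open>\<xi>\<close> on a central bracket into vanishing of the bracket.\<close>

lemma faithful_on_z:
  assumes "\<exists>s\<in>z. blinfun_apply \<xi> s \<noteq> 0" "x \<in> z" "blinfun_apply \<xi> x = 0"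
  shows "x = 0"
proof -
  obtain Z where Z: "z = span {Z}" "Z \<noteq> 0" by (rule z_generator)
  then obtain r where r: "x = r *\<^sub>R Z" using assms(2) by (auto simp: span_singleton)
  have "blinfun_apply \<xi> Z \<noteq> 0" using assms(1) Z by (auto simp: span_singleton blinfun.scaleR_right)
  then show ?thesis using r assms(3) by (auto simp: blinfun.scaleR_right)
qed

lemma obtain_nonzero_on_z: obtains \<xi> :: "'g \<Rightarrow>\<^sub>L real" where "\<exists>s\<in>z. blinfun_apply \<xi> s \<noteq> 0"
proof -
  obtain Z where Z: "z = span {Z}" "Z \<noteq> 0" by (rule z_generator)
  have "\<exists>s\<in>z. blinfun_apply (blinfun_inner_left Z) s \<noteq> 0"
    using Z by (intro bexI[of _ Z]) (auto simp: span_base)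
  then show ?thesis by (rule that)
qed

section \<open>Dimension of the isotropy algebras\<close>

lemma subspace_c_plus_center:
  "subspace {y + w | y w. y \<in> c \<and> w \<in> lie_center br a}"
  by (intro subspace_sums subspaces subspace_center_a)

lemma dim_c_plus_center:
  "dim {y + w | y w. y \<in> c \<and> w \<in> lie_center br a} = dim c + dim (lie_center br a)"
proof (rule dim_sum_direct[OF subspaces(2) subspace_center_a])
  show "c \<inter> lie_center br a = {0}"
    using c_Int_a subspace_0[OF subspace_center_a] zero_mems by (auto simp: lie_center_def)
qed

text \<open>Testing an isotropy element against \<open>c\<close> kills its
  \<open>V\<close>-component, and testing against \<open>a\<close> makes its
  \<open>a\<close>-component central in \<open>a\<close>. So the isotropy algebra lies in
  \<open>?S\<close>; by the duality with \<open>V\<close> it meets \<open>c\<close> only in 0, which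
  leaves at most \<open>dim ?S - dim c\<close>.\<close>

lemma dim_isotropy_le:
  assumes \<xi>: "\<exists>s\<in>z. blinfun_apply \<xi> s \<noteq> 0"
  shows "dim (isotropy br \<xi>) \<le> dim (lie_center br a)"
proof -
  let ?S = "{y + w | y w. y \<in> c \<and> w \<in> lie_center br a}"
  have iso: "isotropy br \<xi> \<subseteq> ?S"
  proof
    fix x assume "x \<in> isotropy br \<xi>"
    then have x0: "blinfun_apply \<xi> (br x u) = 0" for u by (simp add: isotropy_def)
    obtain y v w where x: "y \<in> c" "v \<in> V" "w \<in> a" "x = y + v + w" by (rule decompose)
    have "br y' v = 0" if "y' \<in> c" for y'
    proof -
      have "br x y' = br v y'" using x that by (simp add: br_linear_simps br_c_c br_a_c)
      then have "br v y' = 0" using x0[of y'] faithful_on_z[OF \<xi> br_V_c[OF that x(2)]] by simp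
      then show ?thesis using br_eq_0_commute by blast
    qed
    then have v: "v = 0" using nondegenerate_V x(2) by blast
    have "br w w' = 0" if "w' \<in> a" for w'
    proof -
      have "br x w' = br w w'" using x v that by (simp add: br_linear_simps br_c_a)
      then show ?thesis using x0[of w'] faithful_on_z[OF \<xi> br_a_a[OF x(3) that]] by simp
    qed
    then have "w \<in> lie_center br a" using x(3) by (simp add: lie_center_def)
    then show "x \<in> ?S" using x v by auto
  qed
  have "x = 0" if "x \<in> isotropy br \<xi>" "x \<in> c" for x
  proof (rule nondegenerate_c[OF that(2)])
    fix v assume "v \<in> V"
    then show "br x v = 0"
      using that faithful_on_z[OF \<xi> br_c_V[OF that(2)]] by (simp add: isotropy_def)
  qed
  then have int: "isotropy br \<xi> \<inter> c = {0}"
    using subspace_0[OF subspace_isotropy] zero_mems by auto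
  have "dim (isotropy br \<xi>) + dim c = dim {x + y | x y. x \<in> isotropy br \<xi> \<and> y \<in> c}"
    using dim_sum_direct[OF subspace_isotropy subspaces(2) int] by simp
  also have "\<dots> \<le> dim ?S"
  proof (rule dim_subset, safe)
    fix x y assume xy: "x \<in> isotropy br \<xi>" "y \<in> c"
    then have "x \<in> ?S" using iso by blast
    moreover have "y \<in> ?S" using xy subspace_0[OF subspace_center_a] by force
    ultimately have "x + y \<in> ?S" by (rule subspace_add[OF subspace_c_plus_center])
    then show "\<exists>y' w. x + y = y' + w \<and> y' \<in> c \<and> w \<in> lie_center br a" by blast
  qed
  finally show ?thesis using dim_c_plus_center by simp
qed

text \<open>Elements of \<open>?S\<close> commute with \<open>c\<close> and \<open>a\<close>, so
  lying in the isotropy algebra costs them only the conditions coming from \<open>V\<close>, at most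
  \<open>dim V = dim c\<close> of them.\<close>

lemma dim_isotropy_ge: "dim (lie_center br a) \<le> dim (isotropy br \<xi>)"
proof -
  let ?S = "{y + w | y w. y \<in> c \<and> w \<in> lie_center br a}"
  let ?K = "{x \<in> ?S. \<forall>v\<in>V. blinfun_apply \<xi> (br x v) = 0}"
  have "?K \<subseteq> isotropy br \<xi>"
  proof
    fix x assume "x \<in> ?K"
    then obtain y w where x: "x = y + w" "y \<in> c" "w \<in> lie_center br a"
      and V0: "\<And>v. v \<in> V \<Longrightarrow> blinfun_apply \<xi> (br x v) = 0" by blast
    have w: "w \<in> a" "\<And>w'. w' \<in> a \<Longrightarrow> br w w' = 0" using x(3) by (auto simp: lie_center_def)
    have "blinfun_apply \<xi> (br x u) = 0" for u
    proof -
      obtain y' v w' where u: "y' \<in> c" "v \<in> V" "w' \<in> a" "u = y' + v + w'" by (rule decompose)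
      have "br x y' = 0" "br x w' = 0"
        using x u w by (simp_all add: br_linear_simps br_c_c br_a_c br_c_a)
      then have "br x u = br x v" using u by (simp add: br_linear_simps)
      then show ?thesis using V0 u by simp
    qed
    then show "x \<in> isotropy br \<xi>" by (simp add: isotropy_def)
  qed
  then have "dim ?K \<le> dim (isotropy br \<xi>)" by (rule dim_subset)
  moreover have "dim ?S \<le> dim V + dim ?K"
    using dim_le_dim_plus_annihilator[OF bilinear_apply_br subspace_c_plus_center subspaces(3)] .
  ultimately show ?thesis using dim_c_plus_center dims(1) by simp
qed

lemma generic_if_nonzero_on_z:
  assumes "\<exists>s\<in>z. blinfun_apply \<xi> s \<noteq> 0"
  shows "orbit_dim br \<eta> \<le> orbit_dim br \<xi>"
  using dim_isotropy_le[OF assms] dim_isotropy_ge[of \<eta>] orbit_dim_eq[of \<xi>] orbit_dim_eq[of \<eta>]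
  by linarith

lemma dim_isotropy_generic:
  assumes "\<forall>\<eta>. orbit_dim br \<eta> \<le> orbit_dim br \<xi>"
  shows "dim (isotropy br \<xi>) = dim (lie_center br a)"
proof -
  obtain \<eta> :: "'g \<Rightarrow>\<^sub>L real" where "\<exists>s\<in>z. blinfun_apply \<eta> s \<noteq> 0" by (rule obtain_nonzero_on_z)
  from dim_isotropy_le[OF this] show ?thesis
    using assms[rule_format, of \<eta>] dim_isotropy_ge[of \<xi>] orbit_dim_eq[of \<xi>] orbit_dim_eq[of \<eta>]
    by linarith
qed

lemma z_subset_isotropy: "z \<subseteq> isotropy br \<xi>"
  by (auto simp: isotropy_def br_z)

text \<open>If a generic \<open>\<xi>\<close> vanishes on \<open>z\<close>, its isotropy algebra is
  \<open>z\<close> by dimension, yet contains \<open>c\<close> since brackets with \<open>c\<close>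
  are central. So \<open>c\<close> and \<open>V\<close> vanish and \<open>a\<close> is everything;
  then all brackets are central, and the isotropy algebra is \<open>UNIV\<close>. In the exceptional
  case \<open>z = UNIV\<close> orbits are points and even 0 is generic.\<close>

lemma generic_cases:
  assumes R: "lie_center br a = z" and gen: "\<forall>\<eta>. orbit_dim br \<eta> \<le> orbit_dim br \<xi>"
  shows "(\<exists>s\<in>z. blinfun_apply \<xi> s \<noteq> 0) \<or> z = UNIV"
proof (rule disjCI)
  assume "z \<noteq> UNIV"
  show "\<exists>s\<in>z. blinfun_apply \<xi> s \<noteq> 0"
  proof (rule ccontr)
    assume "\<not> ?thesis"
    then have \<xi>0: "\<And>s. s \<in> z \<Longrightarrow> blinfun_apply \<xi> s = 0" by blast
    have iso: "isotropy br \<xi> = z"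
      using subspace_dim_equal[OF subspaces(1) subspace_isotropy z_subset_isotropy]
        dim_isotropy_generic[OF gen] R by (metis order_refl)
    have "c \<subseteq> isotropy br \<xi>"
    proof
      fix y assume "y \<in> c"
      then have "br x y \<in> z" for x using br_cz c_cz by blast
      then have "br y x \<in> z" for x
        using br_anticommute[of y x] subspaces(1) by (simp add: subspace_neg)
      then show "y \<in> isotropy br \<xi>" using \<xi>0 by (simp add: isotropy_def)
    qed
    then have c0: "c \<subseteq> {0}" using iso z_subset_a c_Int_a by blast
    then have "V \<subseteq> {0}" using nondegenerate_V br_linear_simps by fastforce
    then have "x \<in> a" for x using c0 decompose[of x] by (metis add_0 singletonD subsetD)
    then have "br x y \<in> z" for x y using br_a_a by blast
    then have "isotropy br \<xi> = UNIV" using \<xi>0 by (auto simp: isotropy_def)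
    then show False using iso \<open>z \<noteq> UNIV\<close> by simp
  qed
qed

section \<open>Generic orbits when \<open>a\<close> has center \<open>z\<close>\<close>

lemma exp_ad_z: "s \<in> z \<Longrightarrow> exp_ad br X s = s"
  by (simp add: exp_ad_eq br_z br_linear_simps)

lemma Ad_group_z: "A \<in> Ad_group br \<Longrightarrow> s \<in> z \<Longrightarrow> A s = s"
  by (induction rule: Ad_group.induct) (simp_all add: exp_ad_z)

lemma exp_ad_c:
  assumes "y \<in> c"
  shows "exp_ad br X y = y + br X y"
  using assms by (simp add: exp_ad_eq br_cz c_cz br_z)

lemma mem_orbit_if_agree_on_z:
  assumes R: "lie_center br a = z" and \<xi>: "\<exists>s\<in>z. blinfun_apply \<xi> s \<noteq> 0"
    and agree: "\<And>s. s \<in> z \<Longrightarrow> blinfun_apply \<eta> s = blinfun_apply \<xi> s"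
  shows "\<eta> \<in> coadjoint_orbit br \<xi>"
proof -
  note lin = linear_iff blinfun.bilinear_simps br_linear_simps algebra_simps
  \<comment> \<open>First correction: on \<open>c\<close> the exponential acts by
    \<open>y + br v y\<close>, so the duality of \<open>V\<close> with \<open>c\<close> supplies a
    \<open>v\<close> giving the values of \<open>\<eta>\<close> there.\<close>
  obtain v where v: "v \<in> V"
    "\<And>y. y \<in> c \<Longrightarrow> blinfun_apply \<xi> (br v y) = blinfun_apply \<eta> y - blinfun_apply \<xi> y"
  proof (rule pairing_represents_functional[OF bilinear_apply_br subspaces(3,2)])
    show "linear (\<lambda>y. blinfun_apply \<eta> y - blinfun_apply \<xi> y)" by (simp add: lin)
    fix y assume y: "y \<in> c" "\<And>v. v \<in> V \<Longrightarrow> blinfun_apply \<xi> (br v y) = 0"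
    then have "br v y = 0" if "v \<in> V" for v
      using faithful_on_z[OF \<xi> br_V_c] that by blast
    then have "y = 0" using nondegenerate_c[OF y(1)] br_eq_0_commute by blast
    then show "blinfun_apply \<eta> y - blinfun_apply \<xi> y = 0" by (simp add: blinfun.zero_right)
  qed blast
  define \<xi>1 where "\<xi>1 x = blinfun_apply \<xi> (exp_ad br v x)" for x
  have \<xi>1: "linear \<xi>1"
    unfolding \<xi>1_def using linear_exp_ad[of v] by (simp add: linear_iff blinfun.bilinear_simps)
  have \<xi>1_z: "\<xi>1 s = blinfun_apply \<xi> s" if "s \<in> z" for s by (simp add: \<xi>1_def exp_ad_z that)
  have \<xi>1_c: "\<xi>1 y = blinfun_apply \<eta> y" if "y \<in> c" for y
    using v(2)[OF that] by (simp add: \<xi>1_def exp_ad_c that blinfun.bilinear_simps)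
  \<comment> \<open>Second correction: the radical of the form on \<open>a\<close> is
    \<open>z\<close>, where \<open>\<xi>1\<close> and \<open>\<eta>\<close> already agree, so the
    difference is representable. Brackets within \<open>a\<close> are central, and there
    \<open>\<xi>\<close> and \<open>\<xi>1\<close> coincide.\<close>
  obtain w where w: "w \<in> a"
    "\<And>x. x \<in> a \<Longrightarrow> blinfun_apply \<xi> (br w x) = blinfun_apply \<eta> x - \<xi>1 x"
  proof (rule pairing_represents_functional[OF bilinear_apply_br subspaces(4,4)])
    show "linear (\<lambda>x. blinfun_apply \<eta> x - \<xi>1 x)" using \<xi>1 by (simp add: lin)
    fix x assume x: "x \<in> a" "\<And>w. w \<in> a \<Longrightarrow> blinfun_apply \<xi> (br w x) = 0"
    then have "br w x = 0" if "w \<in> a" for w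
      using faithful_on_z[OF \<xi> br_a_a] that by blast
    then have "x \<in> z" using R x(1) br_eq_0_commute by (auto simp: lie_center_def)
    then show "blinfun_apply \<eta> x - \<xi>1 x = 0" using agree \<xi>1_z by simp
  qed blast
  \<comment> \<open>Third correction: besides the defect on \<open>V\<close>, \<open>y\<close> must
    compensate \<open>\<xi>1 (br w u)\<close>, the change on \<open>V\<close> caused by
    \<open>w\<close>. Since \<open>w + y\<close> commutes with \<open>c\<close>, the first
    correction survives; since \<open>y\<close> commutes with \<open>a\<close>, so does the
    second.\<close>
  obtain y where y: "y \<in> c"
    "\<And>u. u \<in> V \<Longrightarrow> blinfun_apply \<xi> (br y u) = blinfun_apply \<eta> u - \<xi>1 u - \<xi>1 (br w u)"
  proof (rule pairing_represents_functional[OF bilinear_apply_br subspaces(2,3)])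
    show "linear (\<lambda>u. blinfun_apply \<eta> u - \<xi>1 u - \<xi>1 (br w u))"
      using \<xi>1 by (simp add: lin)
    fix u assume u: "u \<in> V" "\<And>y. y \<in> c \<Longrightarrow> blinfun_apply \<xi> (br y u) = 0"
    then have "br y u = 0" if "y \<in> c" for y
      using faithful_on_z[OF \<xi> br_c_V] that by blast
    then have "u = 0" using nondegenerate_V[OF u(1)] by blast
    then show "blinfun_apply \<eta> u - \<xi>1 u - \<xi>1 (br w u) = 0"
      using linear_0[OF \<xi>1] by (simp add: blinfun.zero_right br_linear_simps)
  qed blast
  let ?E = "exp_ad br (w + y)"
  have E_c: "?E x = x" if "x \<in> c" for x
    using that w y by (simp add: exp_ad_eq br_linear_simps br_c_c br_a_c)
  have E_a: "?E x = x + br w x" if "x \<in> a" for x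
    using that w y by (simp add: exp_ad_eq br_linear_simps br_c_a br_a_a br_z)
  have E_V: "?E x = x + br w x + br y x" if "x \<in> V" for x
    using that w y br_a_V[OF w(1) that] br_c_V[OF y(1) that]
    by (simp add: exp_ad_eq br_linear_simps br_c_c br_a_c br_z)
  have c: "\<xi>1 (?E x) = blinfun_apply \<eta> x" if "x \<in> c" for x
    using that by (simp add: E_c \<xi>1_c)
  have V: "\<xi>1 (?E x) = blinfun_apply \<eta> x" if "x \<in> V" for x
    using y(2)[OF that] by (simp add: that E_V linear_add[OF \<xi>1] \<xi>1_z br_c_V y(1))
  have a: "\<xi>1 (?E x) = blinfun_apply \<eta> x" if "x \<in> a" for x
    using w(2)[OF that] by (simp add: that E_a linear_add[OF \<xi>1] \<xi>1_z br_a_a w(1))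
  have "blinfun_apply \<eta> x = blinfun_apply \<xi> ((exp_ad br v \<circ> ?E) x)" for x
  proof -
    obtain x1 x2 x3 where x: "x1 \<in> c" "x2 \<in> V" "x3 \<in> a" "x = x1 + x2 + x3" by (rule decompose)
    have "\<xi>1 (?E x) = blinfun_apply \<eta> x"
      using c[OF x(1)] V[OF x(2)] a[OF x(3)]
      by (simp add: x(4) linear_add[OF linear_exp_ad] linear_add[OF \<xi>1] blinfun.add_right)
    then show ?thesis by (simp add: \<xi>1_def)
  qed
  moreover have "exp_ad br v \<circ> ?E \<in> Ad_group br"
    by (intro Ad_group_comp exp_ad_in_Ad_group)
  ultimately show ?thesis unfolding mem_coadjoint_orbit_iff by blast
qed

lemma generic_orbit_eq:
  assumes R: "lie_center br a = z" and gen: "\<forall>\<eta>. orbit_dim br \<eta> \<le> orbit_dim br \<xi>"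
  shows "coadjoint_orbit br \<xi> = {\<eta>. \<forall>s\<in>z. blinfun_apply \<eta> s = blinfun_apply \<xi> s}"
proof (intro subset_antisym subsetI)
  fix \<eta> assume "\<eta> \<in> coadjoint_orbit br \<xi>"
  then show "\<eta> \<in> {\<eta>. \<forall>s\<in>z. blinfun_apply \<eta> s = blinfun_apply \<xi> s}"
    using Ad_group_z unfolding mem_coadjoint_orbit_iff by fastforce
next
  fix \<eta> assume \<eta>: "\<eta> \<in> {\<eta>. \<forall>s\<in>z. blinfun_apply \<eta> s = blinfun_apply \<xi> s}"
  from generic_cases[OF R gen] show "\<eta> \<in> coadjoint_orbit br \<xi>"
  proof
    assume "z = UNIV"
    then show ?thesis
      using \<eta> unfolding mem_coadjoint_orbit_iff by (intro bexI[OF _ Ad_group.intros(1)]) simp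
  qed (use \<eta> mem_orbit_if_agree_on_z[OF R] in blast)
qed

lemma flat_if_center_a:
  assumes "lie_center br a = z"
  shows "flat_generic_orbits br"
  using generic_orbit_eq[OF assms]
  by (auto simp: flat_generic_orbits_def generic_orbits_def affine_def blinfun.bilinear_simps
      simp flip: distrib_right)

section \<open>Curved orbits when the center of \<open>a\<close> exceeds \<open>z\<close>\<close>

text \<open>By the derivation rule the two sides differ by \<open>br (br u v) x0\<close>, which
  vanishes because \<open>br u v\<close> lies in \<open>c\<close>. So \<open>x0\<close> defines a
  symmetric form on \<open>V\<close>.\<close>

lemma br_V_V_commute:
  assumes "x0 \<in> a" "u \<in> V" "v \<in> V"
  shows "br u (br v x0) = br v (br u x0)"
  using br_br_right[of u v x0] br_c_a[OF assms(1) br_V_V[OF assms(2,3)]] by simp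

text \<open>The components of \<open>X\<close> in \<open>c\<close> and \<open>a\<close> commute with
  \<open>x0\<close> and with \<open>c\<close>, so only the one in \<open>V\<close> acts. By the
  symmetry of the form given by \<open>x0\<close>, these components add up under composition, and
  any group element acts on \<open>x0\<close> and \<open>c\<close> like a single
  \<open>exp_ad br v\<close>.\<close>

lemma Ad_group_shape:
  assumes "A \<in> Ad_group br" and x0: "x0 \<in> lie_center br a"
  shows "\<exists>v\<in>V. A x0 = x0 + br v x0 + (1/2) *\<^sub>R br v (br v x0) \<and> (\<forall>y\<in>c. A y = y + br v y)"
  using assms(1)
proof (induction rule: Ad_group.induct)
  case 1
  show ?case using zero_mems(3) by (intro bexI[of _ 0]) (simp_all add: br_linear_simps)
next
  case (2 A X)
  then obtain v where v: "v \<in> V" "A x0 = x0 + br v x0 + (1/2) *\<^sub>R br v (br v x0)"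
    "\<And>y. y \<in> c \<Longrightarrow> A y = y + br v y" by blast
  obtain y' v' w' where X: "y' \<in> c" "v' \<in> V" "w' \<in> a" "X = y' + v' + w'" by (rule decompose)
  have xa: "x0 \<in> a" "br w' x0 = 0"
    using x0 X(3) br_eq_0_commute by (auto simp: lie_center_def)
  have Xc: "br X y = br v' y" if "y \<in> c" for y
    using X that by (simp add: br_linear_simps br_c_c br_a_c)
  have Xx: "br X x0 = br v' x0"
    using X xa by (simp add: br_linear_simps br_c_a)
  have Ez: "exp_ad br X (br v y) = br v y" if "y \<in> c" for y
    using exp_ad_z br_V_c[OF that v(1)] by blast
  have Ec: "exp_ad br X y = y + br v' y" if "y \<in> c" for y
    using exp_ad_c[OF that] Xc[OF that] by simp
  note lin = linear_add[OF linear_exp_ad] linear_scale[OF linear_exp_ad]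
  have vx: "br v x0 \<in> c" "br v' x0 \<in> c" using br_V_a[OF xa(1)] v(1) X(2) by auto
  have "exp_ad br X x0 = x0 + br v' x0 + (1/2) *\<^sub>R br v' (br v' x0)"
    using Xx Xc[OF vx(2)] by (simp add: exp_ad_eq)
  then have "(exp_ad br X \<circ> A) x0 = x0 + br (v' + v) x0 + (1/2) *\<^sub>R br (v' + v) (br (v' + v) x0)"
    using vx br_V_V_commute[OF xa(1) v(1) X(2)]
    by (simp add: v(2) lin Ec Ez br_linear_simps algebra_simps flip: scaleR_add_left)
  moreover have "(exp_ad br X \<circ> A) y = y + br (v' + v) y" if "y \<in> c" for y
    using that by (simp add: v(3) lin Ec Ez br_linear_simps)
  moreover have "v' + v \<in> V" using X(2) v(1) subspaces(3) by (simp add: subspace_add)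
  ultimately show ?case by blast
qed

text \<open>
  If \<open>x\<^sub>0\<close> is central in \<open>a\<close> but not in the whole algebra, then moving \<open>\<xi>\<close> by
  \<open>exp (s ad v\<^sub>0)\<close> changes \<open>\<xi>|c\<close> linearly in \<open>s\<close> but \<open>\<xi>(x\<^sub>0)\<close> quadratically, while on the
  orbit \<open>\<xi>|c\<close> determines \<open>\<xi>(x\<^sub>0)\<close>: the orbit lies on a paraboloid and contains no midpoint.
\<close>

lemma center_a_if_flat:
  assumes flat: "flat_generic_orbits br"
  shows "lie_center br a = z"
proof (rule ccontr)
  assume "lie_center br a \<noteq> z"
  then obtain x0 where x0: "x0 \<in> lie_center br a" "x0 \<notin> z" using z_subset_center_a by blast
  then have x0a: "x0 \<in> a" "\<And>w. w \<in> a \<Longrightarrow> br x0 w = 0" by (auto simp: lie_center_def)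
  \<comment> \<open>A symmetric form that vanishes on the diagonal is zero. By the duality with
    \<open>V\<close> this would make \<open>x0\<close> commute with \<open>V\<close>, hence
    central.\<close>
  have "\<exists>v\<in>V. br v (br v x0) \<noteq> 0"
  proof (rule ccontr)
    assume "\<not> ?thesis"
    then have sq: "br v (br v x0) = 0" if "v \<in> V" for v using that by blast
    have "br u x0 = 0" if u: "u \<in> V" for u
    proof (rule nondegenerate_c[OF br_V_a[OF x0a(1) u]])
      fix v assume v: "v \<in> V"
      have "br (u + v) (br (u + v) x0) = 0" using sq u v subspaces(3) by (simp add: subspace_add)
      then have "2 *\<^sub>R br v (br u x0) = 0"
        using sq[OF u] sq[OF v] br_V_V_commute[OF x0a(1) u v] by (simp add: br_linear_simps scaleR_2)
      then show "br (br u x0) v = 0" using br_eq_0_commute[of v] by simp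
    qed
    then have V0: "br x0 u = 0" if "u \<in> V" for u using that br_eq_0_commute by blast
    have "br x0 u = 0" for u
    proof -
      obtain y v w where "y \<in> c" "v \<in> V" "w \<in> a" "u = y + v + w" by (rule decompose)
      then show ?thesis using x0a V0 by (simp add: br_linear_simps br_a_c)
    qed
    then show False using x0(2) mem_z_iff by blast
  qed
  then obtain v0 where v0: "v0 \<in> V" "br v0 (br v0 x0) \<noteq> 0" by blast
  obtain \<xi> :: "'g \<Rightarrow>\<^sub>L real" where \<xi>: "\<exists>s\<in>z. blinfun_apply \<xi> s \<noteq> 0" by (rule obtain_nonzero_on_z)
  \<comment> \<open>The midpoint of the points reached with \<open>v0\<close> and
    \<open>- v0\<close>: first-order terms cancel and only the quadratic one remains.\<close>
  define \<mu> where "\<mu> = (1/2) *\<^sub>R coadjoint (exp_ad br (- v0)) \<xi> + (1/2) *\<^sub>R coadjoint (exp_ad br v0) \<xi>"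
  have \<mu>: "blinfun_apply \<mu> x = blinfun_apply \<xi> x + blinfun_apply \<xi> (br v0 (br v0 x)) / 2" for x
    by (simp add: \<mu>_def coadjoint_apply exp_ad_in_Ad_group exp_ad_inverse exp_ad_eq
        blinfun.bilinear_simps br_linear_simps algebra_simps)
  have "coadjoint_orbit br \<xi> \<in> generic_orbits br"
    using generic_if_nonzero_on_z[OF \<xi>] by (auto simp: generic_orbits_def)
  then have "affine (coadjoint_orbit br \<xi>)" using flat by (simp add: flat_generic_orbits_def)
  then have "\<mu> \<in> coadjoint_orbit br \<xi>"
    unfolding \<mu>_def
    by (rule mem_affine) (use exp_ad_in_Ad_group in \<open>auto simp: coadjoint_orbit_def\<close>)
  then obtain A where A: "A \<in> Ad_group br" "\<And>x. blinfun_apply \<mu> x = blinfun_apply \<xi> (A x)"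
    unfolding mem_coadjoint_orbit_iff by blast
  obtain v where v: "v \<in> V" "A x0 = x0 + br v x0 + (1/2) *\<^sub>R br v (br v x0)"
    "\<And>y. y \<in> c \<Longrightarrow> A y = y + br v y"
    using Ad_group_shape[OF A(1) x0(1)] by blast
  \<comment> \<open>On \<open>c\<close> the second-order term vanishes, so \<open>\<mu>\<close>
    equals \<open>\<xi>\<close> there. This forces \<open>v = 0\<close>, hence
    \<open>A x0 = x0\<close>, against the nonzero quadratic term at \<open>x0\<close>.\<close>
  have "br y v = 0" if "y \<in> c" for y
  proof -
    have "br v0 (br v0 y) = 0" using br_V_c[OF that v0(1)] by (simp add: br_z)
    then have "blinfun_apply \<xi> (br v y) = 0"
      using \<mu>[of y] A(2)[of y] v(3)[OF that] by (simp add: blinfun.bilinear_simps)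
    then have "br v y = 0" using faithful_on_z[OF \<xi> br_V_c[OF that v(1)]] by simp
    then show ?thesis using br_eq_0_commute by blast
  qed
  then have "v = 0" using nondegenerate_V[OF v(1)] by blast
  then have "blinfun_apply \<xi> (br v0 (br v0 x0)) = 0"
    using \<mu>[of x0] A(2)[of x0] v(2) by (simp add: br_linear_simps)
  moreover have "br v0 (br v0 x0) \<in> z" using br_V_c[OF br_V_a[OF x0a(1) v0(1)] v0(1)] .
  ultimately show False using faithful_on_z[OF \<xi>] v0(2) by blast
qed

subsection \<open>Heisenberg algebras and Lagrangian subspaces\<close>

text \<open>Bracketing with \<open>(0, \<xi>', w')\<close> in the model shows that only multiples of
  \<open>(1, 0, 0)\<close> can be central. So the center is at most a line, and it contains the line
  \<open>z\<close>.\<close>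

lemma center_a_if_heisenberg:
  assumes "heisenberg_algebra br a"
  shows "lie_center br a = z"
proof -
  obtain W :: "'g set" and f where W: "subspace W" and f: "linear f"
    and bij: "bij_betw f (heisenberg_carrier W) a"
    and hom: "\<And>p q. p \<in> heisenberg_carrier W \<Longrightarrow> q \<in> heisenberg_carrier W \<Longrightarrow>
      f (heisenberg_bracket p q) = br (f p) (f q)"
    using assms unfolding heisenberg_algebra_def lie_isomorphic_def by blast
  have "lie_center br a \<subseteq> span {f (1, 0, 0)}"
  proof
    fix x assume x: "x \<in> lie_center br a"
    then have "x \<in> a" by (simp add: lie_center_def)
    then obtain t \<xi> w where p: "x = f (t, \<xi>, w)" "(t, \<xi>, w) \<in> heisenberg_carrier W"
      using bij unfolding bij_betw_def by (metis imageE prod_cases3)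
    have \<xi>w: "\<xi> \<in> dual_of_subspace W" "w \<in> W" using p(2) by (auto simp: heisenberg_carrier_def)
    have zero: "blinfun_apply \<xi> w' - blinfun_apply \<xi>' w = 0"
      if "\<xi>' \<in> dual_of_subspace W" "w' \<in> W" for \<xi>' w'
    proof -
      have q: "(0, \<xi>', w') \<in> heisenberg_carrier W" using that by (simp add: heisenberg_carrier_def)
      have "f (0, \<xi>', w') \<in> a" using q bij by (auto simp: bij_betw_def)
      then have "br x (f (0, \<xi>', w')) = 0" using x by (simp add: lie_center_def)
      then have "f (blinfun_apply \<xi> w' - blinfun_apply \<xi>' w, 0, 0) = f 0"
        using hom[OF p(2) q] p(1) linear_0[OF f] by (simp add: heisenberg_bracket_def)
      moreover have "(r, 0, 0) \<in> heisenberg_carrier W" "0 \<in> heisenberg_carrier W" for r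
        using subspace_0[OF W] by (simp_all add: heisenberg_carrier_def zero_mem_dual_of_subspace zero_prod_def)
      ultimately have "(blinfun_apply \<xi> w' - blinfun_apply \<xi>' w, 0, 0) = (0 :: real \<times> ('g \<Rightarrow>\<^sub>L real) \<times> 'g)"
        using bij by (meson bij_betw_def inj_onD)
      then show ?thesis by (simp add: zero_prod_def)
    qed
    have "\<xi> = 0"
      using zero[OF zero_mem_dual_of_subspace]
      by (intro dual_of_subspace_eq_0[OF W \<xi>w(1)]) simp
    \<comment> \<open>Testing with the functional given by the inner product with \<open>w\<close>
      yields \<open>w \<bullet> w = 0\<close>.\<close>
    moreover have "w = 0"
      using zero[OF inner_left_mem_dual_of_subspace[OF \<xi>w(2)] subspace_0[OF W]] by simp
    moreover have "f (t, 0, 0) = t *\<^sub>R f (1, 0, 0)"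
      using linear_scale[OF f, of t "(1, 0, 0)"] by simp
    ultimately show "x \<in> span {f (1, 0, 0)}" using p(1) by (simp add: span_base span_scale)
  qed
  then have "dim (lie_center br a) \<le> dim {f (1, 0, 0)}" by (metis dim_span dim_subset)
  also have "\<dots> \<le> card {f (1, 0, 0)}" by (rule dim_le_card') simp
  finally have "dim (lie_center br a) \<le> dim z" using dim_z by simp
  then show ?thesis
    using subspace_dim_equal[OF subspaces(1) subspace_center_a z_subset_center_a] by metis
qed

lemma center_a_if_a_eq_z: "a = z \<Longrightarrow> lie_center br a = z"
  by (auto simp: lie_center_def br_z)

text \<open>Greatest dimension suffices: adjoining an element \<open>x\<close> that commutes with
  \<open>L\<close> keeps the space abelian, so \<open>x\<close> is already in
  \<open>L\<close>.\<close>

lemma ex_maximal_abelian_subspace: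
  obtains L where "subspace L" "L \<subseteq> a" "z \<subseteq> L" "lie_abelian br L"
    "\<forall>x\<in>a. (\<forall>y\<in>L. br x y = 0) \<longrightarrow> x \<in> L"
proof -
  define P where "P L \<longleftrightarrow> subspace L \<and> L \<subseteq> a \<and> z \<subseteq> L \<and> lie_abelian br L" for L
  have Pz: "P z" using subspaces(1) z_subset_a br_z by (auto simp: P_def lie_abelian_def)
  have bound: "\<forall>L. P L \<longrightarrow> dim L < Suc DIM('g)" by (simp add: dim_subset_UNIV less_Suc_eq_le)
  obtain L where L: "P L" "\<And>M. P M \<Longrightarrow> dim M \<le> dim L"
    using ex_has_greatest_nat[where P = P and f = dim, OF Pz bound] by blast
  have "x \<in> L" if x: "x \<in> a" "\<And>y. y \<in> L \<Longrightarrow> br x y = 0" for x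
  proof -
    define M where "M = {l + s | l s. l \<in> L \<and> s \<in> span {x}}"
    have M: "subspace M" unfolding M_def using L(1) by (intro subspace_sums) (auto simp: P_def)
    have x': "br y x = 0" if "y \<in> L" for y using x(2)[OF that] br_eq_0_commute by blast
    have LM: "L \<subseteq> M" "x \<in> M"
      using L(1) span_zero[of "{x}"] span_base[of x "{x}"] subspace_0[of L]
      unfolding M_def P_def by force+
    have "M \<subseteq> a"
      using L(1) x(1) subspaces(4) by (auto simp: M_def P_def span_singleton subspace_add subspace_scale)
    moreover have "lie_abelian br M"
      using L(1) x(2) x'
      by (auto simp: M_def P_def lie_abelian_def span_singleton br_linear_simps br_self)
    ultimately have "P M" using M LM L(1) by (auto simp: P_def)
    then have "L = M"
      using L M LM(1) subspace_dim_equal[of L M] by (auto simp: P_def)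
    then show ?thesis using LM(2) by simp
  qed
  then show ?thesis using that L(1) unfolding P_def by blast
qed

end

section \<open>A Lagrangian in \<open>a\<close> and its complement\<close>

locale Aplus_Lagrangian = Aplus_semidirect +
  fixes L :: "'a set"
  assumes center_a: "lie_center br a = z"
    and subspace_L: "subspace L" and L_a: "L \<subseteq> a" and z_L: "z \<subseteq> L"
    and abelian_L: "lie_abelian br L"
    and maximal_L: "\<forall>x\<in>a. (\<forall>y\<in>L. br x y = 0) \<longrightarrow> x \<in> L"
begin

text \<open>\<open>a\<close> is the sum of \<open>z\<close>, \<open>L1\<close> and \<open>W\<close>,
  and the bracket pairs \<open>L1\<close> with \<open>W\<close> nondegenerately. \<open>W\<close>
  becomes the underlying space of the Heisenberg model, with \<open>L1\<close> as its dual.\<close>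

definition W where "W = {w \<in> a. \<forall>l\<in>L. orthogonal l w}"
definition L1 where "L1 = {l \<in> L. \<forall>s\<in>z. orthogonal s l}"

lemma subspace_W: "subspace W" and subspace_L1: "subspace L1"
  using subspaces(4) subspace_L
  by (auto simp: W_def L1_def subspace_def orthogonal_def inner_add_right)

lemma br_L_L: "x \<in> L \<Longrightarrow> y \<in> L \<Longrightarrow> br x y = 0"
  using abelian_L by (simp add: lie_abelian_def)

lemma W_a: "w \<in> W \<Longrightarrow> w \<in> a" and L1_L: "l \<in> L1 \<Longrightarrow> l \<in> L"
  by (simp_all add: W_def L1_def)

lemma split_a:
  assumes "x \<in> a" obtains l w where "l \<in> L" "w \<in> W" "x = l + w"
  by (rule orthogonal_split[OF subspace_L subspaces(4) L_a assms], rule that) (auto simp: W_def)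

lemma split_L:
  assumes "x \<in> L" obtains s l where "s \<in> z" "l \<in> L1" "x = s + l"
  by (rule orthogonal_split[OF subspaces(1) subspace_L z_L assms], rule that) (auto simp: L1_def)

lemma L_Int_W: "x \<in> L \<Longrightarrow> x \<in> W \<Longrightarrow> x = 0"
  by (auto simp: W_def orthogonal_def)

lemma z_Int_L1: "x \<in> z \<Longrightarrow> x \<in> L1 \<Longrightarrow> x = 0"
  by (auto simp: L1_def orthogonal_def)

text \<open>Such a \<open>w\<close> commutes with all of \<open>L\<close>, so maximality puts it
  into \<open>L\<close>, which meets \<open>W\<close> only in 0.\<close>

lemma nondegenerate_W:
  assumes "w \<in> W" "\<And>l. l \<in> L1 \<Longrightarrow> br l w = 0" shows "w = 0"
proof (rule L_Int_W[OF _ assms(1)])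
  show "w \<in> L"
  proof (rule maximal_L[rule_format, OF W_a[OF assms(1)]])
    fix y assume "y \<in> L"
    then obtain s l where "s \<in> z" "l \<in> L1" "y = s + l" by (rule split_L)
    then have "br y w = 0" using assms(2) by (simp add: br_linear_simps br_z)
    then show "br w y = 0" using br_eq_0_commute by blast
  qed
qed

text \<open>Such an \<open>l\<close> commutes with \<open>W\<close> and with the abelian
  \<open>L\<close>, so it is central in \<open>a\<close>, hence in \<open>z\<close>, which meets
  \<open>L1\<close> only in 0.\<close>

lemma nondegenerate_L1:
  assumes "l \<in> L1" "\<And>w. w \<in> W \<Longrightarrow> br l w = 0" shows "l = 0"
proof (rule z_Int_L1[OF _ assms(1)])
  have "br l x = 0" if x: "x \<in> a" for x
  proof -
    obtain l' w where "l' \<in> L" "w \<in> W" "x = l' + w" using x by (rule split_a)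
    then show ?thesis using assms L1_L br_L_L by (simp add: br_linear_simps)
  qed
  then show "l \<in> z" using center_a L1_L[OF assms(1)] L_a by (auto simp: lie_center_def)
qed

lemma form_coordinate:
  obtains Z where "z = span {Z}" "Z \<bullet> Z = 1"
    "\<forall>x\<in>a. \<forall>y\<in>a. br x y = (br x y \<bullet> Z) *\<^sub>R Z"
proof -
  obtain Z0 where Z0: "z = span {Z0}" "Z0 \<noteq> 0" by (rule z_generator)
  define Z where "Z = sgn Z0"
  have "Z \<bullet> Z = 1" using Z0(2) by (simp add: Z_def norm_sgn dot_square_norm)
  moreover have Z: "z = span {Z}"
    using Z0 span_image_scale[of "{Z0}" "\<lambda>_. inverse (norm Z0)"] by (simp add: Z_def sgn_div_norm)
  moreover have "br x y = (br x y \<bullet> Z) *\<^sub>R Z" if "x \<in> a" "y \<in> a" for x y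
    using br_a_a[OF that] calculation by (auto simp: span_singleton)
  ultimately show ?thesis using that by blast
qed

lemma bilinear_form: "bilinear (\<lambda>x y. br x y \<bullet> Z)" "bilinear (\<lambda>x y. br y x \<bullet> Z)"
  by (auto simp: bilinear_def linear_iff br_linear_simps inner_add_left)

text \<open>The duality gives \<open>dim L1 = dim W\<close>; the extra 1 is the dimension of
  \<open>z\<close>.\<close>

lemma dim_L: "2 * dim L = dim a + 1"
proof -
  obtain Z where Z: "z = span {Z}" "Z \<bullet> Z = 1"
    "\<forall>x\<in>a. \<forall>y\<in>a. br x y = (br x y \<bullet> Z) *\<^sub>R Z"
    by (rule form_coordinate)
  have br0: "br x y = 0" if "x \<in> L1" "y \<in> W" "br x y \<bullet> Z = 0" for x y
    using Z(3) that L1_L W_a L_a by (metis scaleR_zero_left subsetD)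
  have "{x \<in> L1. \<forall>w\<in>W. br x w \<bullet> Z = 0} = {0}"
    using nondegenerate_L1 br0 subspace_0[OF subspace_L1] by (auto simp: br_linear_simps)
  moreover have "{w \<in> W. \<forall>x\<in>L1. br x w \<bullet> Z = 0} = {0}"
    using nondegenerate_W br0 subspace_0[OF subspace_W] by (auto simp: br_linear_simps)
  ultimately have "dim L1 = dim W"
    using dim_le_dim_plus_annihilator[OF bilinear_form(1)[of Z] subspace_L1 subspace_W]
      dim_le_dim_plus_annihilator[OF bilinear_form(2)[of Z] subspace_W subspace_L1] by simp
  moreover have "dim W + dim L = dim a"
    unfolding W_def by (rule dim_subspace_orthogonal_to_vectors[OF subspace_L subspaces(4) L_a])
  moreover have "dim L1 + dim z = dim L"
    unfolding L1_def by (rule dim_subspace_orthogonal_to_vectors[OF subspaces(1) subspace_L z_L])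
  ultimately show ?thesis using dim_z by simp
qed

text \<open>
  With \<open>G\<close> the Riesz map of the form \<open>\<omega>\<close> and \<open>H\<close> its inverse \<open>W \<rightarrow> L1\<close>, the shear
  \<open>w \<mapsto> w - H (G w) / 2\<close> turns the complement \<open>W\<close> of \<open>L\<close> into an isotropic one.
\<close>

lemma heisenberg_a: "heisenberg_algebra br a"
proof -
  obtain Z where Z: "z = span {Z}" "Z \<bullet> Z = 1"
    "\<forall>x\<in>a. \<forall>y\<in>a. br x y = (br x y \<bullet> Z) *\<^sub>R Z"
    by (rule form_coordinate)
  define \<omega> where "\<omega> x y = br x y \<bullet> Z" for x y
  have bil: "bilinear \<omega>" unfolding \<omega>_def by (rule bilinear_form)
  note \<omega>_simps = bilinear_ladd[OF bil] bilinear_radd[OF bil] bilinear_lsub[OF bil]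
    bilinear_rsub[OF bil] bilinear_lmul[OF bil] bilinear_rmul[OF bil]
  have br_\<omega>: "br x y = \<omega> x y *\<^sub>R Z" if "x \<in> a" "y \<in> a" for x y
    using Z(3) that unfolding \<omega>_def by blast
  have skew: "\<omega> x y = - \<omega> y x" for x y
    using br_anticommute[of x y] by (simp add: \<omega>_def)
  have L0: "\<omega> x y = 0" if "x \<in> L" "y \<in> L" for x y using br_L_L[OF that] by (simp add: \<omega>_def)
  have Z0: "\<omega> Z x = 0" "\<omega> x Z = 0" for x
    using Z(1) by (simp_all add: \<omega>_def br_z span_base)
  obtain G where G: "linear G" "range G \<subseteq> W" "\<And>x y. y \<in> W \<Longrightarrow> \<omega> x y = G x \<bullet> y"
    using riesz_on_subspace[OF bil subspace_W] by metis
  have GW: "G x \<in> W" for x using G(2) by blast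
  have br0: "br l w = 0" if "l \<in> L1" "w \<in> W" "\<omega> l w = 0" for l w
    using br_\<omega>[of l w] that L1_L W_a L_a by auto
  have "l = 0" if "l \<in> L1" "G l = 0" for l
    using that nondegenerate_L1 br0 G(3) by simp
  then have "inj_on G L1" using linear_inj_on_iff_eq_0[OF G(1) subspace_L1] by blast
  then obtain H where H: "range H \<subseteq> L1" "linear H" "\<And>l. l \<in> L1 \<Longrightarrow> H (G l) = l"
    using linear_exists_left_inverse_on[OF G(1) subspace_L1] by metis
  have HL: "H x \<in> L1" for x using H(1) by blast
  \<comment> \<open>\<open>H\<close> was obtained as a left inverse on \<open>L1\<close>; that it is
    also a right inverse needs \<open>G\<close> to map \<open>L1\<close> onto \<open>W\<close>,
    which follows by representing \<open>u\<close> through the pairing.\<close>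
  have GH: "G (H u) = u" if u: "u \<in> W" for u
  proof -
    obtain l where l: "l \<in> L1" "\<And>y. y \<in> W \<Longrightarrow> \<omega> l y = u \<bullet> y"
    proof (rule pairing_represents_functional[OF bil subspace_L1 subspace_W])
      show "linear (\<lambda>y. u \<bullet> y)" by (simp add: linear_iff inner_add_right)
      fix w assume w: "w \<in> W" "\<And>l. l \<in> L1 \<Longrightarrow> \<omega> l w = 0"
      then have "w = 0" using nondegenerate_W br0 by blast
      then show "u \<bullet> w = 0" by simp
    qed blast
    have "G l - u \<in> W" using GW u subspace_W by (simp add: subspace_diff)
    then have "(G l - u) \<bullet> (G l - u) = 0"
      using l(2) G(3) by (metis inner_diff_left right_minus_eq)
    then have "G l = u" by simp
    then show ?thesis using H(3)[OF l(1)] by simp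
  qed
  have \<omega>H: "\<omega> (H u) w = u \<bullet> w" if "u \<in> W" "w \<in> W" for u w
    using G(3)[OF that(2)] GH[OF that(1)] by simp
  define f where "f = (\<lambda>(s, \<xi>, w). s *\<^sub>R Z + H (riesz_vector \<xi>) + (w - (1/2) *\<^sub>R H (G w)))"
  note lin = linear_add linear_scale linear_diff
  have "linear f"
    by (rule linearI) (auto simp: f_def lin[OF H(2)] lin[OF G(1)] lin[OF linear_riesz_vector]
        algebra_simps)
  moreover have "bij_betw f (heisenberg_carrier W) a"
  proof (intro bij_betwI')
    fix p q assume p: "p \<in> heisenberg_carrier W" and q: "q \<in> heisenberg_carrier W"
    show "(f p = f q) = (p = q)"
    proof
      assume eq: "f p = f q"
      obtain s \<xi> w where d: "p - q = (s, \<xi>, w)" by (metis prod_cases3)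
      have dW: "\<xi> \<in> dual_of_subspace W" "w \<in> W"
        using p q d subspace_W
        by (auto simp: heisenberg_carrier_def dual_of_subspace_def minus_prod_def
            blinfun.bilinear_simps subspace_diff)
      have "f (s, \<xi>, w) = 0" using eq linear_diff[OF \<open>linear f\<close>, of p q] d by simp
      then have 0: "s *\<^sub>R Z + H (riesz_vector \<xi>) + (w - (1/2) *\<^sub>R H (G w)) = 0" by (simp add: f_def)
      \<comment> \<open>Solving for \<open>w\<close> exhibits it as an element of \<open>L\<close>,
        so it lies in both \<open>L\<close> and its complement.\<close>
      then have "w = (1/2) *\<^sub>R H (G w) - (s *\<^sub>R Z + H (riesz_vector \<xi>))"
        by (simp add: algebra_simps eq_neg_iff_add_eq_0)
      moreover have "\<dots> \<in> L"
        using Z(1) z_L L1_L[OF HL] subspace_L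
        by (intro subspace_diff subspace_add subspace_scale) (auto simp: span_base)
      ultimately have w: "w = 0" using L_Int_W dW(2) by metis
      then have sH: "s *\<^sub>R Z + H (riesz_vector \<xi>) = 0"
        using 0 linear_0[OF G(1)] linear_0[OF H(2)] by simp
      then have "H (riesz_vector \<xi>) = (- s) *\<^sub>R Z" by (simp add: eq_neg_iff_add_eq_0 add.commute)
      then have "H (riesz_vector \<xi>) \<in> z" using Z(1) by (metis rangeI span_singleton)
      then have H0: "H (riesz_vector \<xi>) = 0" using z_Int_L1 HL by blast
      then have "s = 0" using sH Z(2) by auto
      moreover have "riesz_vector \<xi> = 0"
        using H0 GH[OF riesz_vector_mem[OF subspace_W dW(1)]] linear_0[OF G(1)] by simp
      then have "blinfun_apply \<xi> x = 0" for x
        using inner_riesz_vector[of \<xi> x] by simp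
      then have "\<xi> = 0" by (intro blinfun_eqI) simp
      ultimately have "p - q = 0" using d w by (simp add: zero_prod_def)
      then show "p = q" by simp
    qed simp
  next
    fix p assume "p \<in> heisenberg_carrier W"
    then obtain s \<xi> w where p: "p = (s, \<xi>, w)" "w \<in> W" by (auto simp: heisenberg_carrier_def)
    have "s *\<^sub>R Z \<in> a" using Z(1) z_subset_a by (auto simp: span_singleton)
    moreover have "H u \<in> a" for u using HL L1_L L_a by blast
    ultimately show "f p \<in> a"
      using W_a[OF p(2)] subspaces(4)
      by (auto simp: p(1) f_def intro!: subspace_add subspace_diff subspace_scale)
  next
    fix x assume "x \<in> a"
    then obtain l w where x: "l \<in> L" "w \<in> W" "x = l + w" by (rule split_a)
    \<comment> \<open>Adding \<open>H (G w) / 2\<close> to the \<open>L\<close>-part undoes the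
      shear, so the preimage can be read off from the splitting of the result.\<close>
    have "l + (1/2) *\<^sub>R H (G w) \<in> L"
      using x(1) L1_L[OF HL] subspace_L by (simp add: subspace_add subspace_scale)
    then obtain t l1 where t: "t \<in> z" "l1 \<in> L1" "l + (1/2) *\<^sub>R H (G w) = t + l1" by (rule split_L)
    obtain s where s: "t = s *\<^sub>R Z" using t(1) Z(1) by (auto simp: span_singleton)
    have "f (s, blinfun_inner_left (G l1), w) = x"
      using t(3) by (simp add: f_def riesz_vector_inner_left H(3)[OF t(2)] x(3) flip: s)
        (simp add: algebra_simps)
    moreover have "(s, blinfun_inner_left (G l1), w) \<in> heisenberg_carrier W"
      using x(2) GW by (simp add: heisenberg_carrier_def inner_left_mem_dual_of_subspace)
    ultimately show "\<exists>p\<in>heisenberg_carrier W. x = f p" by metis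
  qed
  moreover have "f (heisenberg_bracket p q) = br (f p) (f q)"
    if p: "p \<in> heisenberg_carrier W" and q: "q \<in> heisenberg_carrier W" for p q
  proof -
    obtain s \<xi> w where p': "p = (s, \<xi>, w)" "\<xi> \<in> dual_of_subspace W" "w \<in> W"
      using p by (auto simp: heisenberg_carrier_def)
    obtain s' \<xi>' w' where q': "q = (s', \<xi>', w')" "\<xi>' \<in> dual_of_subspace W" "w' \<in> W"
      using q by (auto simp: heisenberg_carrier_def)
    have fa: "f p \<in> a" "f q \<in> a" using calculation(2) p q by (auto simp: bij_betw_def)
    have HH: "\<omega> (H u) (H u') = 0" for u u' by (intro L0 L1_L HL)
    have H1: "\<omega> (H (riesz_vector \<eta>)) u = blinfun_apply \<eta> u"
      if "\<eta> \<in> dual_of_subspace W" "u \<in> W" for \<eta> u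
      using \<omega>H[OF riesz_vector_mem[OF subspace_W that(1)] that(2)] by (simp add: inner_riesz_vector)
    \<comment> \<open>Each of the two shear terms contributes \<open>- \<omega> w w' / 2\<close>, so
      together they cancel \<open>\<omega> w w'\<close>.\<close>
    have H2: "\<omega> (H (G u)) u' = \<omega> u u'" if "u \<in> W" "u' \<in> W" for u u'
      using \<omega>H[OF GW that(2), of u] G(3)[OF that(2)] by simp
    have "\<omega> (f p) (f q) = blinfun_apply \<xi> w' - blinfun_apply \<xi>' w"
      using H1[OF p'(2) q'(3)] H1[OF q'(2) p'(3)] H2[OF p'(3) q'(3)] H2[OF q'(3) p'(3)]
        skew[of w "H (riesz_vector \<xi>')"] skew[of w "H (G w')"] skew[of w w']
      by (simp add: p'(1) q'(1) f_def \<omega>_simps Z0 HH)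
    then show ?thesis
      using br_\<omega>[OF fa] linear_0[OF H(2)] linear_0[OF G(1)]
      by (simp add: linear_0[OF linear_riesz_vector] p'(1) q'(1) heisenberg_bracket_def f_def)
  qed
  ultimately show ?thesis
    unfolding heisenberg_algebra_def lie_isomorphic_def using subspace_W by blast
qed

section \<open>The common polarization\<close>

definition p where "p = {y + l | y l. y \<in> c \<and> l \<in> L}"

lemma subspace_p: "subspace p"
  unfolding p_def using subspaces(2) subspace_L by (rule subspace_sums)

lemma abelian_p: "lie_abelian br p"
proof -
  have "br (y + l) (y' + l') = 0" if "y \<in> c" "y' \<in> c" "l \<in> L" "l' \<in> L" for y y' l l'
    using that by (simp add: br_linear_simps subsetD[OF L_a] br_c_c br_a_c br_c_a br_L_L)
  then show ?thesis by (auto simp: lie_abelian_def p_def)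
qed

text \<open>Brackets with \<open>c\<close> land in \<open>z\<close>, those of \<open>V\<close> with
  \<open>L\<close> in \<open>c\<close>, and those of \<open>a\<close> with \<open>L\<close> in
  \<open>z\<close>, which is contained in \<open>L\<close>.\<close>

lemma ideal_p: "lie_ideal br p"
proof -
  have sub: "c \<subseteq> p" "L \<subseteq> p"
    using zero_mems(2) subspace_0[OF subspace_L] by (force simp: p_def)+
  have "br x (y + l) \<in> p" if y: "y \<in> c" and l: "l \<in> L" for x y l
  proof -
    obtain y' v w where x: "y' \<in> c" "v \<in> V" "w \<in> a" "x = y' + v + w" by (rule decompose)
    have la: "l \<in> a" using l L_a by blast
    have "br v y \<in> p" "br v l \<in> p" "br w l \<in> p"
      using br_V_c[OF y x(2)] br_V_a[OF la x(2)] br_a_a[OF x(3) la] z_L sub by blast+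
    then have "br v y + br v l + br w l \<in> p" by (intro subspace_add[OF subspace_p])
    moreover have "br x (y + l) = br v y + br v l + br w l"
      using x y la by (simp add: br_linear_simps br_c_c br_a_c br_c_a)
    ultimately show ?thesis by simp
  qed
  then show ?thesis using subspace_p by (auto simp: lie_ideal_def p_def)
qed

text \<open>\<open>p\<close> contains its own centralizer: commuting with \<open>c\<close> removes
  the \<open>V\<close>-component, and commuting with \<open>L\<close> puts the
  \<open>a\<close>-component into \<open>L\<close>.\<close>

lemma maximal_p: "maximal_abelian_ideal br p"
proof -
  have "J \<subseteq> p" if J: "lie_abelian br J" "p \<subseteq> J" for J
  proof
    fix x assume "x \<in> J"
    then have comm: "br x u = 0" if "u \<in> p" for u
      using J that by (auto simp: lie_abelian_def)
    have sub: "c \<subseteq> p" "L \<subseteq> p"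
      using zero_mems(2) subspace_0[OF subspace_L] by (force simp: p_def)+
    obtain y v w where x: "y \<in> c" "v \<in> V" "w \<in> a" "x = y + v + w" by (rule decompose)
    have "br y' v = 0" if y': "y' \<in> c" for y'
    proof -
      have "br x y' = br v y'" using x y' by (simp add: br_linear_simps br_c_c br_a_c)
      then show ?thesis using comm sub y' br_eq_0_commute by (metis subsetD)
    qed
    then have v: "v = 0" using nondegenerate_V[OF x(2)] by blast
    have "w \<in> L"
    proof (rule maximal_L[rule_format, OF x(3)])
      fix l assume l: "l \<in> L"
      then have "br x l = br w l" using x v L_a by (auto simp: br_linear_simps br_c_a)
      then show "br w l = 0" using comm sub l by auto
    qed
    then show "x \<in> p" using x v by (auto simp: p_def)
  qed
  then show ?thesis using ideal_p abelian_p by (auto simp: maximal_abelian_ideal_def)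
qed

text \<open>\<open>dims\<close> and \<open>dim_L\<close> give
  \<open>2 * dim p = DIM('a) + 1\<close>, the required dimension when the isotropy algebra is a
  line.\<close>

lemma polarization_p:
  assumes "dim (isotropy br \<xi>) = 1"
  shows "polarization br \<xi> p"
proof -
  have "c \<inter> L = {0}" using c_Int_a L_a zero_mems(2) subspace_0[OF subspace_L] by blast
  then have "dim p = dim c + dim L"
    unfolding p_def by (intro dim_sum_direct subspaces subspace_L)
  then have "2 * dim p = DIM('a) + 1" using dim_L dims(2) by simp
  then have "real (2 * dim p) = real (DIM('a) + 1)" by (rule arg_cong)
  then have "real (dim p) = (real DIM('a) + 1) / 2" by simp
  moreover have "br x y = 0" if "x \<in> p" "y \<in> p" for x y
    using abelian_p that by (simp add: lie_abelian_def)
  ultimately show ?thesis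
    using assms subspace_p subspace_0[OF subspace_p]
    by (auto simp: polarization_def lie_subalgebra_def)
qed

text \<open>Restriction to \<open>z\<close> is constant along the orbit, so the isotropy bound
  available at \<open>\<xi>0\<close> holds at each of its points.\<close>

lemma polarization_p_generic:
  assumes orb: "\<O> \<in> generic_orbits br" and \<xi>: "\<xi> \<in> \<O>"
  shows "polarization br \<xi> p"
proof (rule polarization_p)
  obtain \<xi>0 where gen: "\<forall>\<eta>. orbit_dim br \<eta> \<le> orbit_dim br \<xi>0" and "\<O> = coadjoint_orbit br \<xi>0"
    using orb by (auto simp: generic_orbits_def)
  then have agree: "\<And>s. s \<in> z \<Longrightarrow> blinfun_apply \<xi> s = blinfun_apply \<xi>0 s"
    using generic_orbit_eq[OF center_a gen] \<xi> by simp
  have "dim (isotropy br \<xi>) \<le> 1"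
    using generic_cases[OF center_a gen]
  proof
    assume "\<exists>s\<in>z. blinfun_apply \<xi>0 s \<noteq> 0"
    then have "\<exists>s\<in>z. blinfun_apply \<xi> s \<noteq> 0" using agree by simp
    then show ?thesis using dim_isotropy_le center_a dim_z by metis
  next
    assume "z = UNIV"
    then show ?thesis using dim_subset[of "isotropy br \<xi>" z] dim_z by simp
  qed
  then show "dim (isotropy br \<xi>) = 1" using dim_isotropy_ge[of \<xi>] center_a dim_z by simp
qed

end

theorem theorem5p2:
  fixes br :: "'g::euclidean_space \<Rightarrow> 'g \<Rightarrow> 'g"
    and k a z c V :: "'g set"
  assumes "lie_algebra br"
    and "reduced_semidirect_product br k a"
    and "lie_center br UNIV = z"
    and "grading_Aplus br k z c V"
    and "lie_nilpotent br a"
    and "\<forall>x\<in>a. \<forall>y\<in>a. br x y \<in> z"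
    and "compatible_with_grading br a z c V"
  shows "(flat_generic_orbits br \<longleftrightarrow> a = z \<or> heisenberg_algebra br a) \<and>
    (flat_generic_orbits br \<longrightarrow>
      (\<exists>p. maximal_abelian_ideal br p \<and>
        (\<forall>\<O>\<in>generic_orbits br. \<forall>\<xi>\<in>\<O>. polarization br \<xi> p)))"
proof -
  interpret Aplus_semidirect br k a z c V
    using assms by (simp add: Aplus_semidirect_def Aplus_semidirect_axioms_def)
  \<comment> \<open>Both assertions pass through the condition that \<open>a\<close> has center
    \<open>z\<close>, from which the Heisenberg structure and the polarization come
    together.\<close>
  have "heisenberg_algebra br a \<and> (\<exists>p. maximal_abelian_ideal br p \<and>
      (\<forall>\<O>\<in>generic_orbits br. \<forall>\<xi>\<in>\<O>. polarization br \<xi> p))"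
    if center: "lie_center br a = z"
  proof -
    obtain L where "subspace L" "L \<subseteq> a" "z \<subseteq> L" "lie_abelian br L"
      "\<forall>x\<in>a. (\<forall>y\<in>L. br x y = 0) \<longrightarrow> x \<in> L"
      using ex_maximal_abelian_subspace by metis
    then interpret Aplus_Lagrangian br k a z c V L
      using center by unfold_locales
    show ?thesis using heisenberg_a maximal_p polarization_p_generic by blast
  qed
  moreover have "flat_generic_orbits br \<longleftrightarrow> lie_center br a = z"
    using flat_if_center_a center_a_if_flat by blast
  ultimately show ?thesis using center_a_if_heisenberg center_a_if_a_eq_z by blast
qed

end
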